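(* For every $\mathcal{L}_{A}^{\Box}$-formula $\varphi$ the following are equivalent: (1) there exists a closed complete $\mathsf{LK'(A)}$-tableau for $\varphi$; (2) $\varphi$ is $\mathsf{LK(A)}$-derivable; (3) $\varphi$ is $\mathsf{K(A)}$-valid.
   Context: $\mathcal{L}_{A}^{\Box}$-formulas are built from a countably infinite set $\mathrm{Var}$ of variables with binary $\wedge,\vee,\&,\to$, constant $\overline{0}$, unary $\Box$; complexity of a formula = number of connective occurrences. A $\mathsf{K(A)}$-model $\langle W,R,V\rangle$: nonempty $W$, $R\subseteq W\times W$, $V\colon\mathrm{Var}\times W\to[-r,r]$ for some real $r\ge0$, extended by $\wedge=\min$, $\vee=\max$, $\&=+$, $V(\varphi\to\psi,x)=V(\psi,x)-V(\varphi,x)$, $V(\overline{0},x)=0$, $V(\Box\varphi,x)=\inf_{\mathbb{R}}\{V(\varphi,y):Rxy\}$ (empty infimum $=0$). $\varphi$ is $\mathsf{K(A)}$-valid if $V(\varphi,x)\ge0$ in all models at all worlds. Calculus $\mathsf{LK(A)}$: a labelled formula is a pair $\varphi^{k}$ (formula, natural number); $n\,\varphi^{k}$ denotes $n$ copies. Nodes are labelled inequations $\Gamma\rhd\Delta$ ($\rhd\in\{>,\ge\}$, $\Gamma,\Delta$ finite multisets of labelled formulas) or relations $rij$. A tableau is a finite tree of nodes grown by rules: if the nodes above the line occur on a branch, the branch may be extended by the nodes below, except branching rules, which split the branch into two, each extended by one alternative; $\rhd$ is preserved. Rules: ($\overline{0}\rhd$) $\Gamma,\overline{0}^{i}\rhd\Delta$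 gives $\Gamma\rhd\Delta$; ($\rhd\overline{0}$) $\Gamma\rhd\overline{0}^{i},\Delta$ gives $\Gamma\rhd\Delta$; ($\&\rhd$) $\Gamma,(\varphi\&\psi)^{i}\rhd\Delta$ gives $\Gamma,\varphi^{i},\psi^{i}\rhd\Delta$; ($\rhd\&$) $\Gamma\rhd(\varphi\&\psi)^{i},\Delta$ gives $\Gamma\rhd\varphi^{i},\psi^{i},\Delta$; ($\to\rhd$) $\Gamma,(\varphi\to\psi)^{i}\rhd\Delta$ gives $\Gamma,\psi^{i}\rhd\varphi^{i},\Delta$; ($\rhd\to$) $\Gamma\rhd(\varphi\to\psi)^{i},\Delta$ gives $\Gamma,\varphi^{i}\rhd\psi^{i},\Delta$; ($\wedge\rhd$) $\Gamma,(\varphi\wedge\psi)^{i}\rhd\Delta$ gives both $\Gamma,\varphi^{i}\rhd\Delta$ and $\Gamma,\psi^{i}\rhd\Delta$; ($\rhd\wedge$, branching) $\Gamma\rhd(\varphi\wedge\psi)^{i},\Delta$ gives $\Gamma\rhd\varphi^{i},\Delta$ or $\Gamma\rhd\psi^{i},\Delta$; ($\vee\rhd$, branching) $\Gamma,(\varphi\vee\psi)^{i}\rhd\Delta$ gives $\Gamma,\varphi^{i}\rhd\Delta$ or $\Gamma,\psi^{i}\rhd\Delta$; ($\rhd\vee$) $\Gamma\rhd(\varphi\vee\psi)^{i},\Delta$ gives both $\Gamma\rhd\varphi^{i},\Delta$ and $\Gamma\rhd\psi^{i},\Delta$; ($\Box\rhd$) from $rij$ and $\Gamma,(\Box\varphi)^{i}\rhd\Delta$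 add $\varphi^{j}\ge(\Box\varphi)^{i}$; ($\rhd\Box$) from $\Gamma\rhd(\Box\varphi)^{i},\Delta$ add $(\Box\varphi)^{i}\ge\varphi^{j}$ and $rij$, $j$ a new label; (ex) from $rik$ add $rkj$, $j$ new. The system associated to a branch consists of the inequations on it containing only labelled formulas $p^{i}$ ($p\in\mathrm{Var}$) and $(\Box\psi)^{i}$, treated as real variables with each side read as a sum (empty sum $=0$); a branch is closed if the system is unsatisfiable over $\mathbb{R}$, a tableau is closed if all branches are. A tableau for $\varphi$ has root $[\,]>[\varphi^{1}]$ followed by $r12$; $\varphi$ is $\mathsf{LK(A)}$-derivable if some tableau for $\varphi$ is closed. Calculus $\mathsf{LK'(A)}$: for each formula $\Box\varphi$ introduce a new variable $[\Box\varphi]$; $\mathrm{Var}^{*}=\mathrm{Var}\cup\{[\Box\varphi]\}$, formulas are over $\mathrm{Var}^{*}$; the complexity of a labelled inequation is the sum of complexities of its formula occurrences. $\mathsf{LK'(A)}$ has the rules of $\mathsf{LK(A)}$ for $\overline{0},\&,\to,\wedge,\vee$ and (ex), with the two box rules replaced by: ($\Box\rhd'$) from relations $rij_1,\dots,rij_s$ and inequations $\Gamma_t,n_t(\Box\varphi)^{i}\rhd\Delta_t$ ($t=1,\dots,m$) add $\varphi^{j_1}\ge[\Box\varphi]^{i},\dots,\varphi^{j_s}\ge[\Box\varphi]^{i}$ and $\Gamma_t,n_t[\Box\varphi]^{i}\rhd\Delta_t$ ($t=1,\dots,m$); ($\rhd\Box'$) from $\Gamma_t\rhd n_t(\Box\varphi)^{i},\Delta_t$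 ($t=1,\dots,m$) add $[\Box\varphi]^{i}\ge\varphi^{j}$, $rij$ and $\Gamma_t\rhd n_t[\Box\varphi]^{i},\Delta_t$ ($t=1,\dots,m$), with $j$ new. Closedness is as for $\mathsf{LK(A)}$ except that the associated system consists of the inequations containing only labelled formulas $q^{i}$ with $q\in\mathrm{Var}^{*}$. A complete $\mathsf{LK'(A)}$-tableau for $\varphi$ is built as follows, marking inequations active/inactive: (1) start with the active inequation $[\,]>[\varphi^{1}]$ and relation $r12$; (2) if all active labelled inequations have complexity $0$, stop; (3) apply the rules for $\overline{0},\&,\to,\wedge,\vee$ exhaustively to active inequations, making the premise inactive and the conclusions active after each application; (4) fix $i$ such that some $(\Box\psi)^{i}$ occurs in an active inequation, and apply (ex) to every branch $B$ containing $(\Box\chi)^{i}$ for some $\Box\chi$ in an active inequation, obtaining relations $rik_B$ for new $k_B$; (5) for each $(\Box\psi)^{i}$ occurring on the right of an active inequation, apply ($\rhd\Box'$) to the collection of all active inequations $\Gamma_t\rhd n_t(\Box\psi)^{i},\Delta_t$ on a branch (with $(\Box\psi)^{i}$ not in $\Delta_t$), making premises inactive and conclusions active; (6) for each $(\Box\psi)^{i}$ occurring on the left of an active inequation, apply ($\Box\rhd'$) to all active inequations $\Gamma_t,n_t(\Box\psi)^{i}\rhd\Delta_t$ (with $(\Box\psi)^{i}$ not in $\Gamma_t$) and all relations $rij_1,\dots,rij_s$ on a branch, making premises inactive and conclusions active; (7) repeat from (2). *)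

theory Defs
  imports Complex_Main "HOL-Library.Multiset"
begin

text \<open>Formulas over a set of variables 'a: binary wedge (min), vee (max), amp (sum), imp (difference),
  constant Zero, unary Box.  The language L_A^Box uses variables of type nat (countably infinite).\<close>

datatype 'a fm = At 'a | Zero | Wedge "'a fm" "'a fm" | Vee "'a fm" "'a fm"
  | Amp "'a fm" "'a fm" | Imp "'a fm" "'a fm" | Box "'a fm"

text \<open>Complexity = number of connective occurrences (the constant Zero counts as a 0-ary connective).\<close>
fun cpx :: "'a fm \<Rightarrow> nat" where
  "cpx (At p) = 0"
| "cpx Zero = 1"
| "cpx (Wedge f g) = Suc (cpx f + cpx g)"
| "cpx (Vee f g) = Suc (cpx f + cpx g)"
| "cpx (Amp f g) = Suc (cpx f + cpx g)"
| "cpx (Imp f g) = Suc (cpx f + cpx g)"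
| "cpx (Box f) = Suc (cpx f)"

fun eval :: "('w \<times> 'w) set \<Rightarrow> ('a \<Rightarrow> 'w \<Rightarrow> real) \<Rightarrow> 'a fm \<Rightarrow> 'w \<Rightarrow> real" where
  "eval R V (At p) x = V p x"
| "eval R V Zero x = 0"
| "eval R V (Wedge f g) x = min (eval R V f x) (eval R V g x)"
| "eval R V (Vee f g) x = max (eval R V f x) (eval R V g x)"
| "eval R V (Amp f g) x = eval R V f x + eval R V g x"
| "eval R V (Imp f g) x = eval R V g x - eval R V f x"
| "eval R V (Box f) x =
     (if {y. (x, y) \<in> R} = {} then 0 else Inf ((\<lambda>y. eval R V f y) ` {y. (x, y) \<in> R}))"

definition kmodel :: "'w set \<Rightarrow> ('w \<times> 'w) set \<Rightarrow> ('a \<Rightarrow> 'w \<Rightarrow> real) \<Rightarrow> bool" where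
  "kmodel W R V \<longleftrightarrow> W \<noteq> {} \<and> R \<subseteq> W \<times> W \<and> (\<exists>r::real. r \<ge> 0 \<and> (\<forall>p. \<forall>x\<in>W. \<bar>V p x\<bar> \<le> r))"

definition kvalid :: "'w itself \<Rightarrow> nat fm \<Rightarrow> bool" where
  "kvalid _ f \<longleftrightarrow> (\<forall>(W::'w set) R (V :: nat \<Rightarrow> 'w \<Rightarrow> real).
       kmodel W R V \<longrightarrow> (\<forall>x\<in>W. eval R V f x \<ge> 0))"

type_synonym 'a lf = "'a fm \<times> nat"

datatype rl = Gt | Ge

datatype 'a node = Ineq "'a lf multiset" rl "'a lf multiset" | Rel nat nat

fun holds :: "rl \<Rightarrow> real \<Rightarrow> real \<Rightarrow> bool" where
  "holds Gt x y = (x > y)"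
| "holds Ge x y = (x \<ge> y)"

fun labels :: "'a node \<Rightarrow> nat set" where
  "labels (Ineq G r D) = snd ` set_mset (G + D)"
| "labels (Rel i k) = {i, k}"

definition fresh :: "nat \<Rightarrow> 'a node set \<Rightarrow> bool" where
  "fresh j B \<longleftrightarrow> (\<forall>c\<in>B. j \<notin> labels c)"

text \<open>A branch (set of nodes) is closed if its associated system, consisting of the inequations
  on it all of whose labelled formulas are "variables" (as specified by isv), treated as real
  unknowns with sides read as sums, is unsatisfiable over the reals.\<close>
definition branch_closed :: "('a fm \<Rightarrow> bool) \<Rightarrow> 'a node set \<Rightarrow> bool" where
  "branch_closed isv B \<longleftrightarrow> \<not> (\<exists>a :: 'a lf \<Rightarrow> real.
      \<forall>G r D. Ineq G r D \<in> B \<longrightarrow> (\<forall>x\<in>#G + D. isv (fst x)) \<longrightarrow>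
        holds r (sum_mset (image_mset a G)) (sum_mset (image_mset a D)))"

text \<open>Rules for Zero, Amp, Imp, Wedge, Vee: a premise inequation and the list of alternatives
  (each alternative is the set of conclusions added to that branch).\<close>
inductive prop_rule :: "'a node \<Rightarrow> 'a node set list \<Rightarrow> bool" where
  zl: "prop_rule (Ineq (G + {#(Zero, i)#}) r D) [{Ineq G r D}]"
| zr: "prop_rule (Ineq G r (D + {#(Zero, i)#})) [{Ineq G r D}]"
| al: "prop_rule (Ineq (G + {#(Amp f g, i)#}) r D) [{Ineq (G + {#(f, i), (g, i)#}) r D}]"
| ar: "prop_rule (Ineq G r (D + {#(Amp f g, i)#})) [{Ineq G r (D + {#(f, i), (g, i)#})}]"
| il: "prop_rule (Ineq (G + {#(Imp f g, i)#}) r D) [{Ineq (G + {#(g, i)#}) r (D + {#(f, i)#})}]"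
| ir: "prop_rule (Ineq G r (D + {#(Imp f g, i)#})) [{Ineq (G + {#(f, i)#}) r (D + {#(g, i)#})}]"
| wl: "prop_rule (Ineq (G + {#(Wedge f g, i)#}) r D)
         [{Ineq (G + {#(f, i)#}) r D, Ineq (G + {#(g, i)#}) r D}]"
| wr: "prop_rule (Ineq G r (D + {#(Wedge f g, i)#}))
         [{Ineq G r (D + {#(f, i)#})}, {Ineq G r (D + {#(g, i)#})}]"
| vl: "prop_rule (Ineq (G + {#(Vee f g, i)#}) r D)
         [{Ineq (G + {#(f, i)#}) r D}, {Ineq (G + {#(g, i)#}) r D}]"
| vr: "prop_rule (Ineq G r (D + {#(Vee f g, i)#}))
         [{Ineq G r (D + {#(f, i)#}), Ineq G r (D + {#(g, i)#})}]"

inductive lk_rule :: "'a node set \<Rightarrow> 'a node set list \<Rightarrow> bool" where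
  prp: "c \<in> B \<Longrightarrow> prop_rule c alts \<Longrightarrow> lk_rule B alts"
| ex: "Rel i k \<in> B \<Longrightarrow> fresh j B \<Longrightarrow> lk_rule B [{Rel k j}]"
| boxl: "Rel i j \<in> B \<Longrightarrow> Ineq (G + {#(Box f, i)#}) r D \<in> B \<Longrightarrow>
           lk_rule B [{Ineq {#(f, j)#} Ge {#(Box f, i)#}}]"
| boxr: "Ineq G r (D + {#(Box f, i)#}) \<in> B \<Longrightarrow> fresh j B \<Longrightarrow>
           lk_rule B [{Ineq {#(Box f, i)#} Ge {#(f, j)#}, Rel i j}]"

text \<open>A tableau is represented by the (finite) set of its branches, each branch by its set of nodes.\<close>
inductive lk_tab :: "'a fm \<Rightarrow> 'a node set set \<Rightarrow> bool" for f where
  init: "lk_tab f {{Ineq {#} Gt {#(f, 1)#}, Rel 1 2}}"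
| step: "lk_tab f T \<Longrightarrow> B \<in> T \<Longrightarrow> lk_rule B alts \<Longrightarrow>
           lk_tab f ((T - {B}) \<union> (\<lambda>C. B \<union> C) ` set alts)"

definition lk_isv :: "'a fm \<Rightarrow> bool" where
  "lk_isv g \<longleftrightarrow> (\<exists>p. g = At p) \<or> (\<exists>h. g = Box h)"

definition lk_derivable :: "'a fm \<Rightarrow> bool" where
  "lk_derivable f \<longleftrightarrow> (\<exists>T. lk_tab f T \<and> (\<forall>B\<in>T. branch_closed lk_isv B))"

text \<open>Var* = Var plus a new variable [Box f] for each formula Box f (over Var*).\<close>
datatype 'v vs = OV 'v | BV "'v vs fm"

definition repl :: "'b \<Rightarrow> 'b \<Rightarrow> 'b multiset \<Rightarrow> 'b multiset" where
  "repl x y M = filter_mset (\<lambda>z. z \<noteq> x) M + replicate_mset (count M x) y"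

fun rconc :: "nat \<Rightarrow> 'v vs fm \<Rightarrow> 'v vs node \<Rightarrow> 'v vs node" where
  "rconc i f (Ineq G r D) = Ineq G r (repl (Box f, i) (At (BV f), i) D)"
| "rconc i f (Rel a b) = Rel a b"

fun lconc :: "nat \<Rightarrow> 'v vs fm \<Rightarrow> 'v vs node \<Rightarrow> 'v vs node" where
  "lconc i f (Ineq G r D) = Ineq (repl (Box f, i) (At (BV f), i) G) r D"
| "lconc i f (Rel a b) = Rel a b"

definition rbox_at :: "nat \<Rightarrow> 'a fm \<Rightarrow> 'a node \<Rightarrow> bool" where
  "rbox_at i f c \<longleftrightarrow> (\<exists>G r D. c = Ineq G r D \<and> (Box f, i) \<in># D)"

definition lbox_at :: "nat \<Rightarrow> 'a fm \<Rightarrow> 'a node \<Rightarrow> bool" where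
  "lbox_at i f c \<longleftrightarrow> (\<exists>G r D. c = Ineq G r D \<and> (Box f, i) \<in># G)"

definition box_in :: "nat \<Rightarrow> ('a node set \<times> 'a node set) set \<Rightarrow> bool" where
  "box_in i T \<longleftrightarrow> (\<exists>(N, A)\<in>T. \<exists>c\<in>A. \<exists>f. rbox_at i f c \<or> lbox_at i f c)"

text \<open>States of the construction: sets of branches, each a pair (nodes, active inequations).\<close>
type_synonym 'a state = "('a node set \<times> 'a node set) set"

definition ineq_cpx :: "'a node \<Rightarrow> nat" where
  "ineq_cpx c = (case c of Ineq G r D \<Rightarrow> sum_mset (image_mset (cpx \<circ> fst) (G + D)) | Rel a b \<Rightarrow> 0)"

definition all_zero :: "'a state \<Rightarrow> bool" where
  "all_zero T \<longleftrightarrow> (\<forall>(N, A)\<in>T. \<forall>c\<in>A. ineq_cpx c = 0)"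

definition p_step :: "'a state \<Rightarrow> 'a state \<Rightarrow> bool" where
  "p_step T T' \<longleftrightarrow> (\<exists>N A c alts. (N, A) \<in> T \<and> c \<in> A \<and> prop_rule c alts \<and>
     T' = (T - {(N, A)}) \<union> (\<lambda>C. (N \<union> C, (A - {c}) \<union> C)) ` set alts)"

definition prop_done :: "'a state \<Rightarrow> bool" where
  "prop_done T \<longleftrightarrow> (\<forall>(N, A)\<in>T. \<forall>c\<in>A. \<not> (\<exists>alts. prop_rule c alts))"

definition ex_step :: "nat \<Rightarrow> 'a state \<Rightarrow> 'a state \<Rightarrow> bool" where
  "ex_step i T T' \<longleftrightarrow> (\<exists>h. T' = h ` T \<and> (\<forall>(N, A)\<in>T.
     if (\<exists>c\<in>A. \<exists>f. rbox_at i f c \<or> lbox_at i f c)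
     then (\<exists>k. fresh k N \<and> h (N, A) = (N \<union> {Rel i k}, A))
     else h (N, A) = (N, A)))"

definition rbox_step :: "nat \<Rightarrow> 'v vs fm \<Rightarrow> 'v vs state \<Rightarrow> 'v vs state \<Rightarrow> bool" where
  "rbox_step i f T T' \<longleftrightarrow> (\<exists>h. T' = h ` T \<and> (\<forall>(N, A)\<in>T.
     (let P = {c\<in>A. rbox_at i f c} in
      if P = {} then h (N, A) = (N, A)
      else (\<exists>j. fresh j N \<and>
        h (N, A) = (N \<union> {Ineq {#(At (BV f), i)#} Ge {#(f, j)#}, Rel i j} \<union> rconc i f ` P,
                    (A - P) \<union> {Ineq {#(At (BV f), i)#} Ge {#(f, j)#}} \<union> rconc i f ` P)))))"

definition lbox_step :: "nat \<Rightarrow> 'v vs fm \<Rightarrow> 'v vs state \<Rightarrow> 'v vs state \<Rightarrow> bool" where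
  "lbox_step i f T T' \<longleftrightarrow> (\<exists>h. T' = h ` T \<and> (\<forall>(N, A)\<in>T.
     (let P = {c\<in>A. lbox_at i f c};
          E = {Ineq {#(f, j)#} Ge {#(At (BV f), i)#} | j. Rel i j \<in> N} in
      if P = {} then h (N, A) = (N, A)
      else h (N, A) = (N \<union> E \<union> lconc i f ` P, (A - P) \<union> E \<union> lconc i f ` P))))"

definition step5 :: "nat \<Rightarrow> 'v vs state \<Rightarrow> 'v vs state \<Rightarrow> bool" where
  "step5 i T T' \<longleftrightarrow>
     (\<lambda>X Y. \<exists>f. (\<exists>(N, A)\<in>X. \<exists>c\<in>A. rbox_at i f c) \<and> rbox_step i f X Y)\<^sup>*\<^sup>* T T' \<and>
     (\<forall>(N, A)\<in>T'. \<forall>c\<in>A. \<forall>f. \<not> rbox_at i f c)"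

definition step6 :: "nat \<Rightarrow> 'v vs state \<Rightarrow> 'v vs state \<Rightarrow> bool" where
  "step6 i T T' \<longleftrightarrow>
     (\<lambda>X Y. \<exists>f. (\<exists>(N, A)\<in>X. \<exists>c\<in>A. lbox_at i f c) \<and> lbox_step i f X Y)\<^sup>*\<^sup>* T T' \<and>
     (\<forall>(N, A)\<in>T'. \<forall>c\<in>A. \<forall>f. \<not> lbox_at i f c)"

definition box_phase :: "'v vs state \<Rightarrow> 'v vs state \<Rightarrow> bool" where
  "box_phase T T' \<longleftrightarrow> ((\<not> (\<exists>i. box_in i T)) \<and> T' = T) \<or>
     (\<exists>i T2 T3. box_in i T \<and> ex_step i T T2 \<and> step5 i T2 T3 \<and> step6 i T3 T')"

definition root_state :: "'v fm \<Rightarrow> 'v vs state" where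
  "root_state f = {({Ineq {#} Gt {#(map_fm OV f, 1)#}, Rel 1 2}, {Ineq {#} Gt {#(map_fm OV f, 1)#}})}"

inductive lkp_run :: "'v fm \<Rightarrow> 'v vs state \<Rightarrow> bool" for f where
  init: "lkp_run f (root_state f)"
| step: "lkp_run f T \<Longrightarrow> \<not> all_zero T \<Longrightarrow> p_step\<^sup>*\<^sup>* T T1 \<Longrightarrow> prop_done T1 \<Longrightarrow>
           box_phase T1 T' \<Longrightarrow> lkp_run f T'"

definition complete_tab :: "'v fm \<Rightarrow> 'v vs state \<Rightarrow> bool" where
  "complete_tab f T \<longleftrightarrow> lkp_run f T \<and> all_zero T"

definition lkp_isv :: "'v vs fm \<Rightarrow> bool" where
  "lkp_isv g \<longleftrightarrow> (\<exists>q. g = At q)"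

definition closed_complete_tab :: "'v fm \<Rightarrow> bool" where
  "closed_complete_tab f \<longleftrightarrow> (\<exists>T. complete_tab f T \<and> (\<forall>(N, A)\<in>T. branch_closed lkp_isv N))"

end

theory Submission
  imports Defs "HOL-Library.Infinite_Set" "HOL-Library.Multiset_Order"
begin

text \<open>
  Soundness of LK(A): infima need not be attained, but in a bounded serial model with a world where
  the formula is negative, every finite tableau has, for each \<open>\<epsilon> > 0\<close>, a branch whose weak inequations
  hold up to \<open>\<epsilon>\<close> and whose strict ones hold with a fixed margin. One branch serves infinitely many
  \<open>\<epsilon> \<longlongrightarrow> 0\<close>, and by boundedness a subsequence of the valuations converges to a solution of its system.

  LK(A) simulates LK'(A) by reading each variable \<open>[\<box>\<phi>]\<close> as \<open>\<box>\<phi>\<close>.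

  The LK'(A) procedure terminates because each rule replaces inequations by finitely many of smaller
  complexity (multiset order). A solution of an open branch of a complete tableau is a valuation on the
  finite tree of labels. There the conclusions of each rule imply its premises, since a label gets all
  its successors while it is processed and is never processed again; so the root inequation is
  true, and the formula is negative at label 1.
\<close>

section \<open>Valuations of labelled inequations\<close>

text \<open>Two features of LK(A) keep the slack under control: no rule combines two inequations, so
  slacks never add up, and the box rules create weak inequations only, so every strict one descends
  from the root by propositional rules and inherits its margin, the negative value of the formula.
  In the countermodel the box rules are asymmetric. On the right, one successor where
  \<open>f\<close> is at most \<open>[Box f]\<close> justifies going back from
  \<open>[Box f]\<close> to \<open>Box f\<close>. On the left, \<open>[Box f]\<close> must lie below
  \<open>f\<close> at all successors, and there must be one, as an empty infimum is 0. Hence the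
  order: (ex), right boxes (which create edges), left boxes. The obstacle is that truth passes from
  later inequations to earlier ones while edges elsewhere are still to come. The invariant therefore
  quantifies over all finite relations agreeing with the branch at the settled labels; at the end it
  is applied to the relation of the branch. Only its unique predecessor could give a settled label
  new formulas, and that one is finished earlier.\<close>

abbreviation msum :: "('b \<Rightarrow> real) \<Rightarrow> 'b multiset \<Rightarrow> real" where
  "msum a G \<equiv> sum_mset (image_mset a G)"

definition lval :: "('w \<times> 'w) set \<Rightarrow> ('a \<Rightarrow> 'w \<Rightarrow> real) \<Rightarrow> (nat \<Rightarrow> 'w) \<Rightarrow> 'a lf \<Rightarrow> real" where
  "lval R V s x = eval R V (fst x) (s (snd x))"

lemma lval_pair [simp]: "lval R V s (g, i) = eval R V g (s i)"
  by (simp add: lval_def)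

fun lfs :: "'a node \<Rightarrow> 'a lf set" where
  "lfs (Ineq G r D) = set_mset (G + D)"
| "lfs (Rel i j) = {}"

lemma finite_lfs [simp]: "finite (lfs c)"
  by (cases c) auto

lemma finite_labels [simp]: "finite (labels c)"
  by (cases c) auto

lemma snd_lfs_labels: "x \<in> lfs c \<Longrightarrow> snd x \<in> labels c"
  by (cases c) auto

lemma box_at_labels: "rbox_at i f c \<Longrightarrow> i \<in> labels c" "lbox_at i f c \<Longrightarrow> i \<in> labels c"
  by (force simp: rbox_at_def lbox_at_def)+

lemma finite_successors:
  fixes N :: "'a node set"
  assumes "finite N" shows "finite {j. Rel i j \<in> N}"
proof (rule finite_imageD)
  show "finite (Rel i ` {j. Rel i j \<in> N} :: 'a node set)" by (rule finite_subset[OF _ assms]) auto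
qed (auto simp: inj_on_def)

lemma fresh_exists:
  assumes "finite N" shows "\<exists>j. fresh j N"
proof -
  have "finite (\<Union>c\<in>N. labels c)" using assms by simp
  then obtain j where "j \<notin> (\<Union>c\<in>N. labels c)" using ex_new_if_finite[OF infinite_UNIV_nat] by blast
  then show ?thesis by (auto simp: fresh_def)
qed

lemma eval_cong_vars:
  "(\<And>p x. p \<in> set_fm g \<Longrightarrow> V p x = V' p x) \<Longrightarrow> eval R V g x = eval R V' g x"
  by (induction g arbitrary: x) auto

lemma eval_map_fm: "eval R V (map_fm h g) x = eval R (\<lambda>p. V (h p)) g x"
  by (induction g arbitrary: x) auto

lemma prop_rule_finite: "prop_rule c alts \<Longrightarrow> C \<in> set alts \<Longrightarrow> finite C"
  by (induction rule: prop_rule.induct) auto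

lemma prop_rule_no_Rel: "prop_rule c alts \<Longrightarrow> C \<in> set alts \<Longrightarrow> Rel i j \<notin> C"
  by (induction rule: prop_rule.induct) auto

section \<open>Steps on a single branch\<close>

abbreviation has_box :: "nat \<Rightarrow> 'a node set \<Rightarrow> bool" where
  "has_box i A \<equiv> \<exists>c\<in>A. \<exists>f. rbox_at i f c \<or> lbox_at i f c"

text \<open>The steps of the procedure act on all branches at once through one function
  \<open>h\<close>. Isolating the effect on a single branch allows simulation, termination and
  invariants to be proved branchwise.\<close>

definition ex_branch :: "nat \<Rightarrow> 'a node set \<times> 'a node set \<Rightarrow> 'a node set \<times> 'a node set \<Rightarrow> bool" where
  "ex_branch i b b' \<longleftrightarrow>
    (if has_box i (snd b) then \<exists>k. fresh k (fst b) \<and> b' = (fst b \<union> {Rel i k}, snd b) else b' = b)"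

definition rbox_branch ::
    "nat \<Rightarrow> 'v vs fm \<Rightarrow> 'v vs node set \<times> 'v vs node set \<Rightarrow> 'v vs node set \<times> 'v vs node set \<Rightarrow> bool" where
  "rbox_branch i f b b' \<longleftrightarrow> (let P = {c\<in>snd b. rbox_at i f c} in
      if P = {} then b' = b
      else (\<exists>j. fresh j (fst b) \<and>
        b' = (fst b \<union> {Ineq {#(At (BV f), i)#} Ge {#(f, j)#}, Rel i j} \<union> rconc i f ` P,
              (snd b - P) \<union> {Ineq {#(At (BV f), i)#} Ge {#(f, j)#}} \<union> rconc i f ` P)))"

definition lbox_branch ::
    "nat \<Rightarrow> 'v vs fm \<Rightarrow> 'v vs node set \<times> 'v vs node set \<Rightarrow> 'v vs node set \<times> 'v vs node set \<Rightarrow> bool" where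
  "lbox_branch i f b b' \<longleftrightarrow> (let P = {c\<in>snd b. lbox_at i f c};
          E = {Ineq {#(f, j)#} Ge {#(At (BV f), i)#} | j. Rel i j \<in> fst b} in
      if P = {} then b' = b
      else b' = (fst b \<union> E \<union> lconc i f ` P, (snd b - P) \<union> E \<union> lconc i f ` P))"

lemma ex_step_iff: "ex_step i T T' \<longleftrightarrow> (\<exists>h. T' = h ` T \<and> (\<forall>b\<in>T. ex_branch i b (h b)))"
  by (simp only: ex_step_def ex_branch_def split_def prod.collapse)

lemma rbox_step_iff: "rbox_step i f T T' \<longleftrightarrow> (\<exists>h. T' = h ` T \<and> (\<forall>b\<in>T. rbox_branch i f b (h b)))"
  by (simp only: rbox_step_def rbox_branch_def split_def prod.collapse)

lemma lbox_step_iff: "lbox_step i f T T' \<longleftrightarrow> (\<exists>h. T' = h ` T \<and> (\<forall>b\<in>T. lbox_branch i f b (h b)))"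
  by (simp only: lbox_step_def lbox_branch_def split_def prod.collapse)

lemma ex_branch_cases:
  assumes "ex_branch i (N, A) b'"
  obtains (keep) "\<not> has_box i A" "b' = (N, A)"
    | (extend) k where "has_box i A" "fresh k N" "b' = (N \<union> {Rel i k}, A)"
  using assms unfolding ex_branch_def fst_conv snd_conv by (cases "has_box i A") (simp_all only: if_True if_False, blast+)

lemma rbox_branch_cases:
  assumes "rbox_branch i f (N, A) b'"
  obtains (keep) "{c\<in>A. rbox_at i f c} = {}" "b' = (N, A)"
    | (extend) P j e where "P = {c\<in>A. rbox_at i f c}" "P \<noteq> {}" "fresh j N" "e = Ineq {#(At (BV f), i)#} Ge {#(f, j)#}"
      "b' = (N \<union> {e, Rel i j} \<union> rconc i f ` P, (A - P) \<union> {e} \<union> rconc i f ` P)"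
proof (cases "{c\<in>A. rbox_at i f c} = {}")
  case True
  then have "b' = (N, A)" using assms unfolding rbox_branch_def Let_def fst_conv snd_conv by (simp only: if_True)
  then show thesis using True keep by blast
next
  case False
  then show thesis using assms extend[OF refl False _ refl]
    unfolding rbox_branch_def Let_def fst_conv snd_conv by (simp only: if_False) blast
qed

lemma lbox_branch_cases:
  assumes "lbox_branch i f (N, A) b'"
  obtains (keep) "{c\<in>A. lbox_at i f c} = {}" "b' = (N, A)"
    | (extend) P E where "P = {c\<in>A. lbox_at i f c}" "P \<noteq> {}"
      "E = (\<lambda>j. Ineq {#(f, j)#} Ge {#(At (BV f), i)#}) ` {j. Rel i j \<in> N}"
      "b' = (N \<union> E \<union> lconc i f ` P, (A - P) \<union> E \<union> lconc i f ` P)"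
proof (cases "{c\<in>A. lbox_at i f c} = {}")
  case True
  then have "b' = (N, A)" using assms unfolding lbox_branch_def Let_def fst_conv snd_conv by (simp only: if_True)
  then show thesis using True keep by blast
next
  case False
  then show thesis using assms extend[OF refl False refl]
    unfolding lbox_branch_def Let_def fst_conv snd_conv setcompr_eq_image by (simp only: if_False)
qed

section \<open>Soundness of LK(A)\<close>

text \<open>The infimum defining a boxed formula need not be attained, so weak inequations are
  only satisfied up to a slack, while strict ones keep a fixed margin (a negative slack).\<close>

fun approx :: "(rl \<Rightarrow> real) \<Rightarrow> ('a lf \<Rightarrow> real) \<Rightarrow> 'a node \<Rightarrow> bool" where
  "approx e a (Ineq G r D) \<longleftrightarrow> msum a D \<le> msum a G + e r"
| "approx e a (Rel i j) \<longleftrightarrow> True"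

text \<open>Sums are only rearranged, or a min or max is replaced by one of its arguments; a
  branching rule follows the argument that attains it. So the slack is unchanged, whatever its
  sign.\<close>

lemma prop_rule_forward:
  assumes "prop_rule c alts" "approx e (lval R V s) c"
  shows "\<exists>C\<in>set alts. \<forall>c'\<in>C. approx e (lval R V s) c'"
  using assms by (induction rule: prop_rule.induct) (auto simp: min_def max_def split: if_splits)

lemma lk_tab_finite:
  assumes "lk_tab f T" shows "finite T \<and> (\<forall>B\<in>T. finite B)"
  using assms
proof induction
  case (step T B alts)
  have "finite C" if "C \<in> set alts" for C
    using step(3) that by (cases rule: lk_rule.cases) (auto elim: prop_rule.cases)
  then show ?case using step by auto
qed simp

text \<open>Bolzano-Weierstrass, one coordinate at a time: each new element of \<open>S\<close>
  costs a further monotone subsequence.\<close>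

lemma convergent_subseq_pointwise:
  fixes a :: "nat \<Rightarrow> 'b \<Rightarrow> real"
  assumes "finite S" "\<And>x n. x \<in> S \<Longrightarrow> \<bar>a n x\<bar> \<le> M x"
  shows "\<exists>l k. strict_mono k \<and> (\<forall>x\<in>S. (\<lambda>n. a (k n) x) \<longlonglongrightarrow> l x)"
  using assms
proof (induction S)
  case empty then show ?case by (auto intro!: exI[of _ "\<lambda>n. n"] simp: strict_mono_def)
next
  case (insert z S)
  then obtain l k where k: "strict_mono k" "\<forall>x\<in>S. (\<lambda>n. a (k n) x) \<longlonglongrightarrow> l x" by auto
  obtain m :: "nat \<Rightarrow> nat" where m: "strict_mono m" "monoseq (\<lambda>n. a (k (m n)) z)"
    using seq_monosub[of "\<lambda>n. a (k n) z"] by blast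
  have "Bseq (\<lambda>n. a (k (m n)) z)" using insert.prems by (intro BseqI'[where K = "M z"]) auto
  then obtain L where L: "(\<lambda>n. a (k (m n)) z) \<longlonglongrightarrow> L"
    using m Bseq_monoseq_convergent convergent_def by blast
  have "(\<lambda>n. a (k (m n)) x) \<longlonglongrightarrow> l x" if "x \<in> S" for x
    using LIMSEQ_subseq_LIMSEQ[OF k(2)[rule_format, OF that] m(1)] by (simp add: o_def)
  then have "\<forall>x\<in>insert z S. (\<lambda>n. a ((k \<circ> m) n) x) \<longlonglongrightarrow> (l(z := L)) x"
    using L insert.hyps by auto
  then show ?case using strict_mono_o[OF k(1) m(1)] by blast
qed

lemma tendsto_msum:
  "(\<And>x. x \<in># G \<Longrightarrow> (\<lambda>n. a n x) \<longlonglongrightarrow> l x) \<Longrightarrow> (\<lambda>n. msum (a n) G) \<longlonglongrightarrow> msum l G"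
  by (induction G) (auto intro!: tendsto_add)

locale bounded_serial_model =
  fixes R :: "('w \<times> 'w) set" and V :: "'a \<Rightarrow> 'w \<Rightarrow> real" and r :: real
  assumes ser: "\<exists>y. (x, y) \<in> R" and bd: "\<bar>V p x\<bar> \<le> r"
begin

text \<open>The bound depends on the formula but not on the world. It makes the infima genuine and
  confines each coordinate of the valuations to a bounded interval.\<close>

lemma eval_bounded: "\<exists>M. \<forall>x. \<bar>eval R V g x\<bar> \<le> M"
proof (induction g)
  case (At p) then show ?case using bd by auto
next
  case Zero then show ?case by auto
next
  case (Wedge f g)
  then obtain M N where "\<forall>x. \<bar>eval R V f x\<bar> \<le> M" "\<forall>x. \<bar>eval R V g x\<bar> \<le> N" by auto
  then have "\<forall>x. \<bar>eval R V (Wedge f g) x\<bar> \<le> max M N" by (auto simp: min_def le_max_iff_disj)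
  then show ?case by blast
next
  case (Vee f g)
  then obtain M N where "\<forall>x. \<bar>eval R V f x\<bar> \<le> M" "\<forall>x. \<bar>eval R V g x\<bar> \<le> N" by auto
  then have "\<forall>x. \<bar>eval R V (Vee f g) x\<bar> \<le> max M N" by (auto simp: max_def[of "eval _ _ _ _"] le_max_iff_disj)
  then show ?case by blast
next
  case (Amp f g)
  then obtain M N where MN: "\<forall>x. \<bar>eval R V f x\<bar> \<le> M" "\<forall>x. \<bar>eval R V g x\<bar> \<le> N" by auto
  have "\<bar>eval R V (Amp f g) x\<bar> \<le> M + N" for x using MN(1)[rule_format, of x] MN(2)[rule_format, of x] by simp
  then show ?case by blast
next
  case (Imp f g)
  then obtain M N where MN: "\<forall>x. \<bar>eval R V f x\<bar> \<le> M" "\<forall>x. \<bar>eval R V g x\<bar> \<le> N" by auto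
  have "\<bar>eval R V (Imp f g) x\<bar> \<le> M + N" for x using MN(1)[rule_format, of x] MN(2)[rule_format, of x] by simp
  then show ?case by blast
next
  case (Box g)
  then obtain M where M: "\<forall>x. \<bar>eval R V g x\<bar> \<le> M" by auto
  have "\<bar>eval R V (Box g) x\<bar> \<le> M" for x
  proof -
    have "{y. (x, y) \<in> R} \<noteq> {}" using ser by auto
    moreover from this have "\<bar>Inf ((\<lambda>y. eval R V g y) ` {y. (x, y) \<in> R})\<bar> \<le> M"
      using M by (intro cInf_abs_ge) auto
    ultimately show ?thesis by (simp del: Collect_empty_eq)
  qed
  then show ?case by blast
qed

text \<open>Slack is spent only for a box on the right, where a successor within \<open>e Ge\<close>
  of the infimum is chosen; the inequation added for a box on the left holds exactly.\<close>

lemma lk_rule_forward: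
  assumes rule: "lk_rule B alts" and e: "e Ge > 0"
    and ap: "\<forall>c\<in>B. approx e (lval R V s) c" and rel: "\<And>i j. Rel i j \<in> B \<Longrightarrow> (s i, s j) \<in> R"
  shows "\<exists>C\<in>set alts. \<exists>s'. (\<forall>c\<in>B \<union> C. approx e (lval R V s') c) \<and> (\<forall>i j. Rel i j \<in> B \<union> C \<longrightarrow> (s' i, s' j) \<in> R)"
proof -
  \<comment> \<open>A fresh label may be sent to any world without affecting the nodes already
    present.\<close>
  have upd: "(\<forall>c\<in>B. approx e (lval R V (s(j := y))) c) \<and> (\<forall>i k. Rel i k \<in> B \<longrightarrow> ((s(j := y)) i, (s(j := y)) k) \<in> R)"
    if "fresh j B" for j y
  proof (intro conjI ballI allI impI)
    fix c assume c: "c \<in> B"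
    then have *: "j \<notin> labels c" using that by (auto simp: fresh_def)
    show "approx e (lval R V (s(j := y))) c"
    proof (cases c)
      case (Ineq G q D)
      have "image_mset (lval R V (s(j := y))) G = image_mset (lval R V s) G"
        "image_mset (lval R V (s(j := y))) D = image_mset (lval R V s) D"
        using * Ineq by (force intro!: image_mset_cong simp: lval_def)+
      then show ?thesis using ap c Ineq by fastforce
    qed simp
  next
    fix i k assume "Rel i k \<in> B"
    then show "((s(j := y)) i, (s(j := y)) k) \<in> R" using that rel by (auto simp: fresh_def)
  qed
  have ne: "{y. (x, y) \<in> R} \<noteq> {}" for x using ser by auto
  have bdd: "bdd_below ((\<lambda>y. eval R V g y) ` {y. (x, y) \<in> R})" for g x
  proof -
    obtain M where "\<forall>x. \<bar>eval R V g x\<bar> \<le> M" using eval_bounded[of g] by blast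
    then show ?thesis by (intro bdd_belowI2[where m = "-M"]) (metis abs_le_iff minus_le_iff)
  qed
  from rule show ?thesis
  proof cases
    case (prp c)
    obtain C where C: "C \<in> set alts" "\<forall>c'\<in>C. approx e (lval R V s) c'"
      using prop_rule_forward[OF prp(2)] ap prp(1) by blast
    have "Rel i j \<notin> C" for i j using prp(2) C(1) by (cases rule: prop_rule.cases) auto
    then show ?thesis using C ap rel by (intro bexI[of _ C] exI[of _ s]) auto
  next
    case (ex i k j)
    obtain y where "(s k, y) \<in> R" using ser by blast
    moreover have "k \<noteq> j" using ex by (auto simp: fresh_def)
    ultimately show ?thesis using upd[OF ex(3), of y] ex(1) by (auto intro!: exI[of _ "s(j := y)"])
  next
    case (boxl i j G f q D)
    have "eval R V (Box f) (s i) \<le> eval R V f (s j)"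
      using ne rel[OF boxl(2)] bdd by (auto intro!: cInf_lower)
    then show ?thesis using boxl ap rel e by (auto intro!: exI[of _ s] simp del: eval.simps)
  next
    case (boxr G q D f i j)
    have "Inf ((\<lambda>y. eval R V f y) ` {y. (s i, y) \<in> R}) < eval R V (Box f) (s i) + e Ge" using ne e by (simp del: Collect_empty_eq)
    then obtain y where y: "(s i, y) \<in> R" "eval R V f y < eval R V (Box f) (s i) + e Ge"
      using ne by (subst (asm) cInf_less_iff[OF _ bdd]) auto
    have "i \<noteq> j" using boxr(2,3) by (auto simp: fresh_def)
    then show ?thesis using upd[OF boxr(3), of y] boxr(1) y
      by (auto intro!: exI[of _ "s(j := y)"] simp del: eval.simps)
  qed
qed

lemma lk_tab_approx:
  assumes T: "lk_tab f T" and e: "e Ge > 0" and w: "eval R V f w \<le> e Gt"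
  shows "\<exists>B\<in>T. \<exists>s. (\<forall>c\<in>B. approx e (lval R V s) c) \<and> (\<forall>i j. Rel i j \<in> B \<longrightarrow> (s i, s j) \<in> R)"
  using T
proof induction
  case init
  obtain y where "(w, y) \<in> R" using ser by blast
  then show ?case using w by (auto intro!: exI[of _ "\<lambda>i. if i = 1 then w else y"])
next
  case (step T B alts)
  then obtain B' s where B': "B' \<in> T" "\<forall>c\<in>B'. approx e (lval R V s) c" "\<forall>i j. Rel i j \<in> B' \<longrightarrow> (s i, s j) \<in> R" by blast
  show ?case
  proof (cases "B' = B")
    case True
    then show ?thesis using lk_rule_forward[of B alts e s] step(3) e B' by blast
  qed (use B' in blast)
qed

lemma lk_sound_serial:
  assumes der: "lk_derivable f"
  shows "eval R V f w \<ge> 0"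
proof (rule ccontr)
  define d where "d = eval R V f w"
  assume "\<not> eval R V f w \<ge> 0"
  then have d: "d < 0" by (simp add: d_def)
  obtain T where T: "lk_tab f T" "\<And>B. B \<in> T \<Longrightarrow> branch_closed lk_isv B" using der by (auto simp: lk_derivable_def)
  \<comment> \<open>The gap \<open>d\<close> of strict inequations stays fixed while the slack of
    weak ones tends to 0.\<close>
  define e where "e n q = (case q of Gt \<Rightarrow> d | Ge \<Rightarrow> inverse (real (Suc n)))" for n q
  have "\<exists>B\<in>T. \<exists>s. \<forall>c\<in>B. approx (e n) (lval R V s) c" for n
    using lk_tab_approx[OF T(1), of "e n" w] by (fastforce simp: e_def d_def)
  then obtain B s where B: "B n \<in> T" "\<And>c. c \<in> B n \<Longrightarrow> approx (e n) (lval R V (s n)) c" for n by metis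
  \<comment> \<open>The branch found depends on \<open>n\<close>, but a tableau has finitely many,
    so one branch \<open>C\<close> recurs infinitely often.\<close>
  have "finite (range B)" using B(1) lk_tab_finite[OF T(1)] by (metis finite_subset image_subsetI)
  then obtain C where C: "infinite {n. B n = C}"
    using pigeonhole_infinite[of UNIV B] by (auto simp: infinite_UNIV_nat)
  then have "C \<in> T" using B(1) not_finite_existsD by blast
  define K where "K = enumerate {n. B n = C}"
  have K: "strict_mono K" "\<And>n. B (K n) = C"
    using C strict_mono_enumerate enumerate_in_set[OF C] by (auto simp: K_def)
  define S where "S = (\<Union>c\<in>C. lfs c)"
  have "finite S" using lk_tab_finite[OF T(1)] \<open>C \<in> T\<close> by (auto simp: S_def)
  obtain M where M: "\<And>g x. \<bar>eval R V g x\<bar> \<le> M g" using eval_bounded by metis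
  obtain l k where k: "strict_mono k" and l: "\<And>x. x \<in> S \<Longrightarrow> (\<lambda>n. lval R V (s (K (k n))) x) \<longlonglongrightarrow> l x"
    using convergent_subseq_pointwise[OF \<open>finite S\<close>, of "\<lambda>n. lval R V (s (K n))" "\<lambda>x. M (fst x)"] M
    by (metis lval_def)
  have Kk: "strict_mono (K \<circ> k)" using K(1) k by (rule strict_mono_o)
  \<comment> \<open>The limit \<open>l\<close> need not be a valuation in any model; a real solution
    of the system of \<open>C\<close> is enough. Strictness survives the limit because
    \<open>d\<close> does not depend on \<open>n\<close>.\<close>
  have "holds q (msum l G) (msum l D)" if "Ineq G q D \<in> C" for G q D
  proof -
    have GD: "x \<in> S" if "x \<in># G + D" for x using that \<open>Ineq G q D \<in> C\<close> unfolding S_def by force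
    have lG: "(\<lambda>n. msum (lval R V (s (K (k n)))) G) \<longlonglongrightarrow> msum l G"
      and lD: "(\<lambda>n. msum (lval R V (s (K (k n)))) D) \<longlonglongrightarrow> msum l D"
      using l GD by (auto intro!: tendsto_msum)
    have ap: "msum (lval R V (s (K (k n)))) D \<le> msum (lval R V (s (K (k n)))) G + e (K (k n)) q" for n
      using B(2)[of "Ineq G q D" "K (k n)"] K(2) that by auto
    have le: "(\<lambda>n. e (K (k n)) q) \<longlonglongrightarrow> (case q of Gt \<Rightarrow> d | Ge \<Rightarrow> 0)"
    proof (cases q)
      case Ge
      then show ?thesis using LIMSEQ_subseq_LIMSEQ[OF LIMSEQ_inverse_real_of_nat Kk] by (simp add: e_def o_def)
    qed (simp add: e_def)
    have "msum l D \<le> msum l G + (case q of Gt \<Rightarrow> d | Ge \<Rightarrow> 0)"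
      by (rule LIMSEQ_le[OF lD tendsto_add[OF lG le]]) (use ap in auto)
    then show ?thesis using d by (cases q) auto
  qed
  then show False using T(2)[OF \<open>C \<in> T\<close>] unfolding branch_closed_def by blast
qed

end

text \<open>Rule (ex) is sound only in serial models; dead ends are removed by adding a reflexive world
  where every formula has value 0.\<close>

lemma lk_sound:
  fixes f :: "nat fm"
  assumes "lk_derivable f" shows "kvalid TYPE('w) f"
  unfolding kvalid_def
proof (intro allI impI ballI)
  fix W :: "'w set" and R and V :: "nat \<Rightarrow> 'w \<Rightarrow> real" and x
  assume m: "kmodel W R V" and x: "x \<in> W"
  then obtain r where RW: "R \<subseteq> W \<times> W" and r: "r \<ge> 0" "\<And>p x. x \<in> W \<Longrightarrow> \<bar>V p x\<bar> \<le> r"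
    by (auto simp: kmodel_def)
  \<comment> \<open>For \<open>z = None\<close> the condition is vacuous, which gives the loop.
    Elements outside \<open>W\<close> have no \<open>R\<close>-successor and are also sent to
    \<open>None\<close>.\<close>
  define R' where "R' = {(Some x, Some y) | x y. (x, y) \<in> R} \<union>
    {(z, None) | z. \<forall>x. z = Some x \<longrightarrow> (\<forall>y. (x, y) \<notin> R)}"
  \<comment> \<open>The locale wants one bound on the whole type, hence 0 outside \<open>W\<close>.
    The value 0 at \<open>None\<close> matches the convention for the empty infimum.\<close>
  define V' where "V' p z = (case z of None \<Rightarrow> 0 | Some x \<Rightarrow> if x \<in> W then V p x else 0)" for p z
  have none: "{y. (None, y) \<in> R'} = {None}" by (auto simp: R'_def)
  have dead: "{y. (Some x, y) \<in> R'} = {None}" if "{y. (x, y) \<in> R} = {}" for x using that by (auto simp: R'_def)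
  have live: "{y. (Some x, y) \<in> R'} = Some ` {y. (x, y) \<in> R}" if "{y. (x, y) \<in> R} \<noteq> {}" for x
    using that by (auto simp: R'_def)
  have e0: "eval R' V' g None = 0" for g by (induction g) (auto simp: V'_def none)
  have e1: "x \<in> W \<Longrightarrow> eval R' V' g (Some x) = eval R V g x" for g x
  proof (induction g arbitrary: x)
    case (Box g)
    show ?case
    proof (cases "{y. (x, y) \<in> R} = {}")
      case True then show ?thesis using dead e0 by simp
    next
      case False
      have "(\<lambda>y. eval R' V' g y) ` {y. (Some x, y) \<in> R'} = (\<lambda>y. eval R V g y) ` {y. (x, y) \<in> R}"
        unfolding live[OF False] image_image using Box.IH RW by (intro image_cong) auto
      then show ?thesis using False live[OF False] by (simp del: Collect_empty_eq)
    qed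
  qed (auto simp: V'_def)
  have "eval R' V' f (Some x) \<ge> 0"
  proof (rule bounded_serial_model.lk_sound_serial[OF _ assms], unfold_locales)
    show "\<exists>y. (z, y) \<in> R'" for z by (cases z) (auto simp: R'_def)
    show "\<bar>V' p z\<bar> \<le> r" for p z using r by (auto simp: V'_def split: option.splits)
  qed
  then show "eval R V f x \<ge> 0" using e1 x by simp
qed

section \<open>Simulation of LK'(A) in LK(A)\<close>

text \<open>Closability of one branch by itself. In a tableau, being a set, extended branches may
  coincide with each other or with old ones; the simulation need not track this.\<close>

inductive lk_closable :: "'a node set \<Rightarrow> bool" where
  closed: "branch_closed lk_isv B \<Longrightarrow> lk_closable B"
| rule: "lk_rule B alts \<Longrightarrow> (\<And>C. C \<in> set alts \<Longrightarrow> lk_closable (B \<union> C)) \<Longrightarrow> lk_closable B"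

text \<open>The tableau is arbitrary so that the induction hypothesis for one alternative applies to
  whatever tableau the treatment of the previous alternatives has produced.\<close>

lemma lk_closable_extend:
  assumes "lk_closable B" "lk_tab f T"
  shows "\<exists>T'. lk_tab f T' \<and> (\<forall>B'\<in>T'. B' \<in> T - {B} \<or> branch_closed lk_isv B')"
  using assms
proof (induction arbitrary: T)
  case (closed B)
  then show ?case by (intro exI[of _ T]) auto
next
  case (rule B alts)
  show ?case
  proof (cases "B \<in> T")
    case False
    then show ?thesis using rule.prems by blast
  next
    case True
    define T1 where "T1 = (T - {B}) \<union> (\<lambda>C. B \<union> C) ` set alts"
    have T1: "lk_tab f T1" unfolding T1_def using lk_tab.step[OF rule.prems True rule.hyps(1)] .
    \<comment> \<open>The alternatives in \<open>earlier\<close> have been closed, those in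
      \<open>later\<close> may still be open; each step moves one across.\<close>
    have "\<exists>T'. lk_tab f T' \<and> (\<forall>B'\<in>T'. B' \<in> T - {B} \<or> branch_closed lk_isv B' \<or> B' \<in> (\<lambda>C. B \<union> C) ` set later)"
      if "alts = earlier @ later" for earlier later
      using that
    proof (induction earlier arbitrary: later rule: rev_induct)
      case Nil
      then show ?case using T1 by (intro exI[of _ T1]) (auto simp: T1_def)
    next
      case (snoc C earlier)
      then obtain T2 where T2: "lk_tab f T2" "\<forall>B'\<in>T2. B' \<in> T - {B} \<or> branch_closed lk_isv B' \<or> B' \<in> (\<lambda>C. B \<union> C) ` set (C # later)"
        by (metis append.assoc append_Cons append_Nil)
      have "C \<in> set alts" using snoc.prems by simp
      from rule.IH[OF this T2(1)] obtain T' where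
        "lk_tab f T'" "\<forall>B'\<in>T'. B' \<in> T2 - {B \<union> C} \<or> branch_closed lk_isv B'" by blast
      then show ?case using T2(2) by (intro exI[of _ T']) auto
    qed
    from this[of alts "[]"] show ?thesis by auto
  qed
qed

lemma lk_closable_derivable:
  assumes "lk_closable {Ineq {#} Gt {#(f, 1)#}, Rel 1 2}" shows "lk_derivable f"
  using lk_closable_extend[OF assms lk_tab.init[of f]] unfolding lk_derivable_def by blast

section \<open>Translation from \<open>Var*\<close> back to the original language\<close>

function (sequential) unbv :: "'v vs fm \<Rightarrow> 'v fm" where
  "unbv (At (OV p)) = At p"
| "unbv (At (BV g)) = Box (unbv g)"
| "unbv Zero = Zero"
| "unbv (Wedge f g) = Wedge (unbv f) (unbv g)"
| "unbv (Vee f g) = Vee (unbv f) (unbv g)"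
| "unbv (Amp f g) = Amp (unbv f) (unbv g)"
| "unbv (Imp f g) = Imp (unbv f) (unbv g)"
| "unbv (Box f) = Box (unbv f)"
  by pat_completeness auto
text \<open>The recursion descends into atoms \<open>At (BV g)\<close>, which the plain size of a
  formula does not look into; \<open>size_fm size\<close> counts the variables too.\<close>

termination by (relation "measure (size_fm size)") auto

lemma unbv_map_OV [simp]: "unbv (map_fm OV f) = f"
  by (induction f) auto

lemma lk_isv_unbv: "lkp_isv g \<Longrightarrow> lk_isv (unbv g)"
proof -
  assume "lkp_isv g"
  then obtain q where "g = At q" by (auto simp: lkp_isv_def)
  then show ?thesis by (cases q) (auto simp: lk_isv_def)
qed

definition unbv_lf :: "(nat \<Rightarrow> nat) \<Rightarrow> 'v vs lf \<Rightarrow> 'v lf" where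
  "unbv_lf s x = (unbv (fst x), s (snd x))"

lemma unbv_lf_pair [simp]: "unbv_lf s (g, i) = (unbv g, s i)"
  by (simp add: unbv_lf_def)

fun unbv_node :: "(nat \<Rightarrow> nat) \<Rightarrow> 'v vs node \<Rightarrow> 'v node" where
  "unbv_node s (Ineq G r D) = Ineq (image_mset (unbv_lf s) G) r (image_mset (unbv_lf s) D)"
| "unbv_node s (Rel i j) = Rel (s i) (s j)"

text \<open>As \<open>Box f\<close> and \<open>[Box f]\<close> have the same translation, the
  renamed conclusions of the LK'(A) box rules translate to their own premises and cost nothing in
  LK(A).\<close>

lemma image_mset_repl: "h x = h y \<Longrightarrow> image_mset h (repl x y M) = image_mset h M"
  unfolding repl_def by (induction M) auto

lemma unbv_rconc [simp]: "unbv_node s (rconc i f c) = unbv_node s c"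
  by (cases c) (auto simp: image_mset_repl)

lemma unbv_lconc [simp]: "unbv_node s (lconc i f c) = unbv_node s c"
  by (cases c) (auto simp: image_mset_repl)

lemma unbv_node_upd: "j \<notin> labels c \<Longrightarrow> unbv_node (s(j := k)) c = unbv_node s c"
  by (cases c) (force intro!: image_mset_cong simp: unbv_lf_def)+

text \<open>Propositional rules keep the label of the formula they decompose and are uniform in it,
  so even a non-injective \<open>s\<close> maps instances to instances.\<close>

lemma prop_rule_unbv:
  "prop_rule c alts \<Longrightarrow> prop_rule (unbv_node s c) (map (\<lambda>C. unbv_node s ` C) alts)"
  by (induction rule: prop_rule.induct) (auto intro: prop_rule.intros[simplified])

lemma prop_rule_labels: "prop_rule c alts \<Longrightarrow> C \<in> set alts \<Longrightarrow> c' \<in> C \<Longrightarrow> labels c' \<subseteq> labels c"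
  by (induction rule: prop_rule.induct) auto

lemma snd_repl: "snd ` set_mset (repl (x, i) (y, i) M) = snd ` set_mset M"
proof -
  have "image_mset snd (repl (x, i) (y, i) M) = image_mset snd M" by (simp add: image_mset_repl)
  then show ?thesis by (metis set_image_mset)
qed

lemma labels_rconc [simp]: "labels (rconc i f c) = labels c"
  by (cases c) (simp_all add: image_Un snd_repl)

lemma labels_lconc [simp]: "labels (lconc i f c) = labels c"
  by (cases c) (simp_all add: image_Un snd_repl)

text \<open>LK(A) has no successor-creating rule for label 1, so the successor that LK'(A) creates there
  is mapped to the initial label 2; hence the label map need not be injective.\<close>

definition simulates :: "(nat \<Rightarrow> nat) \<Rightarrow> 'v node set \<Rightarrow> 'v vs node set \<times> 'v vs node set \<Rightarrow> bool" where
  "simulates s B b \<longleftrightarrow> (case b of (N, A) \<Rightarrow> finite N \<and> A \<subseteq> N \<and> finite B \<and> Rel 1 2 \<in> B \<and>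
     unbv_node s ` N \<subseteq> B \<and> (\<forall>c\<in>N. \<forall>i\<in>labels c. s i = 1 \<or> (\<exists>l. Rel l (s i) \<in> B)))"

text \<open>A solution for \<open>B\<close> pulls back along \<open>unbv_lf s\<close> to one for
  \<open>N\<close>. Identifying labels only adds constraints, so \<open>s\<close> need not be
  injective.\<close>

lemma simulates_closed:
  assumes "simulates s B (N, A)" "branch_closed lkp_isv N"
  shows "branch_closed lk_isv B"
  unfolding branch_closed_def
proof
  assume "\<exists>a. \<forall>G r D. Ineq G r D \<in> B \<longrightarrow> (\<forall>x\<in>#G + D. lk_isv (fst x)) \<longrightarrow> holds r (msum a G) (msum a D)"
  then obtain a where a: "\<And>G r D. Ineq G r D \<in> B \<Longrightarrow> (\<forall>x\<in>#G + D. lk_isv (fst x)) \<Longrightarrow> holds r (msum a G) (msum a D)" by blast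
  have "holds r (msum (a \<circ> unbv_lf s) G) (msum (a \<circ> unbv_lf s) D)"
    if "Ineq G r D \<in> N" "\<forall>x\<in>#G + D. lkp_isv (fst x)" for G r D
  proof -
    have "unbv_node s (Ineq G r D) \<in> B" using assms(1) that(1) by (auto simp: simulates_def)
    then have "holds r (msum a (image_mset (unbv_lf s) G)) (msum a (image_mset (unbv_lf s) D))"
      using that(2) by (intro a) (force simp: unbv_lf_def lk_isv_unbv)+
    then show ?thesis by (simp add: multiset.map_comp)
  qed
  then show False using assms(2) unfolding branch_closed_def by blast
qed

text \<open>Closedness is known only at the end of a run, so the property is carried backwards to
  the root; this is why it quantifies over every simulating \<open>s\<close> and
  \<open>B\<close>.\<close>

abbreviation all_closable :: "'v vs state \<Rightarrow> bool" where
  "all_closable T \<equiv> \<forall>b\<in>T. \<forall>s B. simulates s B b \<longrightarrow> lk_closable B"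

lemma all_closable_p_step:
  assumes "p_step T T'" "all_closable T'" shows "all_closable T"
proof (intro ballI allI impI)
  fix b s B assume b: "b \<in> T" and sim: "simulates s B b"
  obtain N A c alts where st: "(N, A) \<in> T" "c \<in> A" "prop_rule c alts"
    "T' = (T - {(N, A)}) \<union> (\<lambda>C. (N \<union> C, (A - {c}) \<union> C)) ` set alts"
    using assms(1) by (auto simp: p_step_def)
  show "lk_closable B"
  proof (cases "b = (N, A)")
    case True
    show ?thesis
    proof (rule lk_closable.rule)
      have "unbv_node s c \<in> B" using sim st(2) True by (auto simp: simulates_def)
      then show "lk_rule B (map (\<lambda>C. unbv_node s ` C) alts)"
        using prop_rule_unbv[OF st(3)] by (rule lk_rule.prp)
      fix C' assume "C' \<in> set (map (\<lambda>C. unbv_node s ` C) alts)"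
      then obtain C where C: "C \<in> set alts" "C' = unbv_node s ` C" by auto
      have "simulates s (B \<union> C') (N \<union> C, (A - {c}) \<union> C)"
        unfolding simulates_def prod.case
      proof (intro conjI ballI)
        fix c' i assume "c' \<in> N \<union> C" "i \<in> labels c'"
        then have "\<exists>c\<in>N. i \<in> labels c" using prop_rule_labels[OF st(3) C(1)] st(2) sim True
          by (auto simp: simulates_def)
        then show "s i = 1 \<or> (\<exists>l. Rel l (s i) \<in> B \<union> C')" using sim True by (fastforce simp: simulates_def)
      qed (use sim st(2) True C(2) prop_rule_finite[OF st(3) C(1)] in \<open>auto simp: simulates_def\<close>)
      then show "lk_closable (B \<union> C')" using assms(2) st(4) C(1) by blast
    qed
  next
    case False then show ?thesis using b sim assms(2) st(4) by blast
  qed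
qed

text \<open>LK'(A) treats all successors in one application, LK(A) one successor at a time.\<close>

lemma lk_closable_boxl_set:
  assumes "finite J" "\<And>j. j \<in> J \<Longrightarrow> Rel i j \<in> B" "Ineq (G + {#(Box f, i)#}) r D \<in> B"
    "lk_closable (B \<union> (\<lambda>j. Ineq {#(f, j)#} Ge {#(Box f, i)#}) ` J)"
  shows "lk_closable B"
  using assms
proof (induction J arbitrary: B)
  case (insert j J)
  have "lk_closable (B \<union> {Ineq {#(f, j)#} Ge {#(Box f, i)#}})"
    by (rule insert.IH) (use insert.prems in auto)
  then show ?case using lk_closable.rule[OF lk_rule.boxl[of i j B G f r D]] insert.prems by auto
qed simp

lemma simulates_ex_branch:
  assumes "ex_branch i b b'" "simulates s B b" and cl: "\<And>s' B'. simulates s' B' b' \<Longrightarrow> lk_closable B'"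
  shows "lk_closable B"
proof -
  obtain N A where b: "b = (N, A)" by (cases b)
  have sim: "finite N" "A \<subseteq> N" "finite B" "Rel 1 2 \<in> B" "unbv_node s ` N \<subseteq> B"
    "\<forall>c\<in>N. \<forall>i\<in>labels c. s i = 1 \<or> (\<exists>l. Rel l (s i) \<in> B)"
    using assms(2) b by (auto simp: simulates_def)
  from assms(1)[unfolded b] show ?thesis
  proof (cases rule: ex_branch_cases)
    case keep
    then show ?thesis using cl assms(2) b by blast
  next
    case (extend k)
    obtain c where c: "c \<in> N" "i \<in> labels c" using extend(1) sim(2) box_at_labels by blast
    have ki: "k \<noteq> i" using extend(2) c by (auto simp: fresh_def)
    have upd: "unbv_node (s(k := m)) ` N = unbv_node s ` N" for m
      using extend(2) by (intro image_cong) (auto simp: fresh_def unbv_node_upd)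
    have lab: "\<forall>c\<in>N. k \<notin> labels c" using extend(2) by (auto simp: fresh_def)
    \<comment> \<open>The image \<open>m\<close> of the new label is left open: it will be 2 when
      \<open>s i = 1\<close> and a fresh label otherwise. \<open>X\<close> is what LK(A) adds for
      it.\<close>
    have sim': "simulates (s(k := m)) (B \<union> X) b'" if "Rel (s i) m \<in> B \<union> X" "finite X" for m X
      unfolding simulates_def extend(3) prod.case
    proof (intro conjI ballI)
      show "unbv_node (s(k := m)) ` (N \<union> {Rel i k}) \<subseteq> B \<union> X"
        using upd[of m] sim(5) ki that by (simp add: image_Un) blast
      fix c' j assume "c' \<in> N \<union> {Rel i k}" "j \<in> labels c'"
      then have "j = k \<or> j \<noteq> k \<and> (\<exists>c\<in>N. j \<in> labels c)" using lab c by auto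
      then show "(s(k := m)) j = 1 \<or> (\<exists>l. Rel l ((s(k := m)) j) \<in> B \<union> X)"
        using sim(6) that by auto
    qed (use sim that in auto)
    show ?thesis
    proof (cases "s i = 1")
      case True
      then show ?thesis using cl[OF sim'[of 2 "{}"]] sim(4) by simp
    next
      case False
      then obtain l where l: "Rel l (s i) \<in> B" using sim(6) c by auto
      obtain j where j: "fresh j B" using fresh_exists sim(3) by auto
      have "lk_closable (B \<union> {Rel (s i) j})" by (rule cl[OF sim'[of j]]) auto
      then show ?thesis using lk_closable.rule[OF lk_rule.ex[OF l j]] by simp
    qed
  qed
qed

lemma simulates_rbox_branch:
  assumes "rbox_branch i f b b'" "simulates s B b" and cl: "\<And>s' B'. simulates s' B' b' \<Longrightarrow> lk_closable B'"
  shows "lk_closable B"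
proof -
  obtain N A where b: "b = (N, A)" by (cases b)
  have sim: "finite N" "A \<subseteq> N" "finite B" "Rel 1 2 \<in> B" "unbv_node s ` N \<subseteq> B"
    "\<forall>c\<in>N. \<forall>i\<in>labels c. s i = 1 \<or> (\<exists>l. Rel l (s i) \<in> B)"
    using assms(2) b by (auto simp: simulates_def)
  from assms(1)[unfolded b] show ?thesis
  proof (cases rule: rbox_branch_cases)
    case keep
    then show ?thesis using cl assms(2) b by blast
  next
    case (extend P j e)
    have PN: "P \<subseteq> N" using sim(2) extend(1) by auto
    then have "finite P" using sim(1) by (rule finite_subset)
    obtain c where c: "c \<in> N" "rbox_at i f c" using extend(1,2) PN by blast
    have ji: "j \<noteq> i" using extend(3) c box_at_labels by (auto simp: fresh_def)
    have lab: "\<forall>c\<in>N. j \<notin> labels c" using extend(3) by (auto simp: fresh_def)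
    \<comment> \<open>Any single premise triggers the LK(A) rule.\<close>
    obtain G r D where D: "c = Ineq G r (D + {#(Box f, i)#})"
      using c(2) by (auto simp: rbox_at_def dest: multi_member_split)
    have "unbv_node s c \<in> B" using sim(5) c by auto
    then have inB: "Ineq (image_mset (unbv_lf s) G) r (image_mset (unbv_lf s) D + {#(Box (unbv f), s i)#}) \<in> B"
      by (simp add: D)
    obtain k where k: "fresh k B" using fresh_exists sim(3) by auto
    define B' where "B' = B \<union> {Ineq {#(Box (unbv f), s i)#} Ge {#(unbv f, k)#}, Rel (s i) k}"
    have upd: "unbv_node (s(j := k)) c = unbv_node s c" if "c \<in> N" for c
      using lab that by (auto simp: unbv_node_upd)
    have inB': "unbv_node (s(j := k)) c \<in> B'" if "c \<in> N" for c
      using sim(5) upd[OF that] that by (auto simp: B'_def)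
    have "simulates (s(j := k)) B' b'"
      unfolding simulates_def extend(5) prod.case
    proof (intro conjI ballI)
      show "unbv_node (s(j := k)) ` (N \<union> {e, Rel i j} \<union> rconc i f ` P) \<subseteq> B'"
      proof (rule image_subsetI)
        fix c assume "c \<in> N \<union> {e, Rel i j} \<union> rconc i f ` P"
        then consider "c \<in> N" | "c = e" | "c = Rel i j" | c' where "c = rconc i f c'" "c' \<in> N" using PN by blast
        then show "unbv_node (s(j := k)) c \<in> B'"
          by cases (use inB' ji in \<open>simp_all add: extend(4) B'_def\<close>)
      qed
      fix c' m assume "c' \<in> N \<union> {e, Rel i j} \<union> rconc i f ` P" "m \<in> labels c'"
      then have "m = j \<or> m = i \<or> (\<exists>c\<in>N. m \<in> labels c)" using PN by (auto simp: extend(4))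
      then have "m = j \<or> (m \<noteq> j \<and> (\<exists>c\<in>N. m \<in> labels c))" using lab c box_at_labels by blast
      then show "(s(j := k)) m = 1 \<or> (\<exists>l. Rel l ((s(j := k)) m) \<in> B')"
        using sim(6) by (auto simp: B'_def)
    qed (use sim PN \<open>finite P\<close> in \<open>auto simp: B'_def\<close>)
    then have "lk_closable B'" by (rule cl)
    then show ?thesis using lk_closable.rule[OF lk_rule.boxr[OF inB k]] by (simp add: B'_def)
  qed
qed

lemma simulates_lbox_branch:
  assumes "lbox_branch i f b b'" "simulates s B b" and cl: "\<And>s' B'. simulates s' B' b' \<Longrightarrow> lk_closable B'"
  shows "lk_closable B"
proof -
  obtain N A where b: "b = (N, A)" by (cases b)
  have sim: "finite N" "A \<subseteq> N" "finite B" "Rel 1 2 \<in> B" "unbv_node s ` N \<subseteq> B"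
    "\<forall>c\<in>N. \<forall>i\<in>labels c. s i = 1 \<or> (\<exists>l. Rel l (s i) \<in> B)"
    using assms(2) b by (auto simp: simulates_def)
  from assms(1)[unfolded b] show ?thesis
  proof (cases rule: lbox_branch_cases)
    case keep
    then show ?thesis using cl assms(2) b by blast
  next
    case (extend P E)
    have PN: "P \<subseteq> N" using sim(2) extend(1) by auto
    then have "finite P" using sim(1) by (rule finite_subset)
    obtain c where c: "c \<in> N" "lbox_at i f c" using extend(1,2) PN by blast
    obtain G r D where D: "c = Ineq (G + {#(Box f, i)#}) r D"
      using c(2) by (auto simp: lbox_at_def dest: multi_member_split)
    have "unbv_node s c \<in> B" using sim(5) c by auto
    then have inB: "Ineq (image_mset (unbv_lf s) G + {#(Box (unbv f), s i)#}) r (image_mset (unbv_lf s) D) \<in> B"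
      by (simp add: D)
    define J where "J = {j. Rel i j \<in> N}"
    have finJ: "finite J" unfolding J_def using sim(1) by (rule finite_successors)
    define B' where "B' = B \<union> (\<lambda>j. Ineq {#(unbv f, j)#} Ge {#(Box (unbv f), s i)#}) ` (s ` J)"
    have "simulates s B' b'"
      unfolding simulates_def extend(4) prod.case
    proof (intro conjI ballI)
      show "unbv_node s ` (N \<union> E \<union> lconc i f ` P) \<subseteq> B'"
      proof (rule image_subsetI)
        fix c assume "c \<in> N \<union> E \<union> lconc i f ` P"
        then consider "c \<in> N" | j where "j \<in> J" "c = Ineq {#(f, j)#} Ge {#(At (BV f), i)#}"
          | c' where "c = lconc i f c'" "c' \<in> N" using PN unfolding extend(3) J_def by blast
        then show "unbv_node s c \<in> B'"
          by cases (use sim(5) in \<open>auto simp: B'_def\<close>)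
      qed
      fix c' m assume "c' \<in> N \<union> E \<union> lconc i f ` P" "m \<in> labels c'"
      then have "Rel i m \<in> N \<or> m = i \<or> (\<exists>c\<in>N. m \<in> labels c)" using PN by (auto simp: extend(3))
      then have "\<exists>c\<in>N. m \<in> labels c" using c box_at_labels(2)[OF c(2)] by (auto intro: bexI[of _ "Rel i m"] bexI[of _ c])
      then show "s m = 1 \<or> (\<exists>l. Rel l (s m) \<in> B')"
        using sim(6) by (auto simp: B'_def)
    qed (use sim PN \<open>finite P\<close> finJ in \<open>auto simp: B'_def extend(3) J_def\<close>)
    then have "lk_closable B'" by (rule cl)
    moreover have "Rel (s i) j \<in> B" if j: "j \<in> s ` J" for j
    proof -
      obtain m where "j = s m" "Rel i m \<in> N" using j by (auto simp: J_def)
      then show ?thesis using sim(5) by force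
    qed
    ultimately show ?thesis using lk_closable_boxl_set[OF _ _ inB, of "s ` J"] finJ by (auto simp: B'_def)
  qed
qed

lemma all_closable_image:
  assumes "T' = h ` T" "\<forall>b\<in>T. Q b (h b)" "all_closable T'"
    and "\<And>b b' s B. Q b b' \<Longrightarrow> simulates s B b \<Longrightarrow> (\<And>s' B'. simulates s' B' b' \<Longrightarrow> lk_closable B') \<Longrightarrow> lk_closable B"
  shows "all_closable T"
proof (intro ballI allI impI)
  fix b s B assume "b \<in> T" "simulates s B b"
  then show "lk_closable B" using assms(1-3) by (intro assms(4)[of b "h b" s B]) blast+
qed

lemma all_closable_ex_step: "ex_step i T T' \<Longrightarrow> all_closable T' \<Longrightarrow> all_closable T"
  unfolding ex_step_iff by (elim exE conjE) (rule all_closable_image[OF _ _ _ simulates_ex_branch])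

lemma all_closable_rbox_step: "rbox_step i f T T' \<Longrightarrow> all_closable T' \<Longrightarrow> all_closable T"
  unfolding rbox_step_iff by (elim exE conjE) (rule all_closable_image[OF _ _ _ simulates_rbox_branch])

lemma all_closable_lbox_step: "lbox_step i f T T' \<Longrightarrow> all_closable T' \<Longrightarrow> all_closable T"
  unfolding lbox_step_iff by (elim exE conjE) (rule all_closable_image[OF _ _ _ simulates_lbox_branch])

lemma all_closable_box_phase:
  assumes "box_phase T T'" "all_closable T'" shows "all_closable T"
proof (cases "T' = T")
  case False
  then obtain i T2 T3 where ph: "ex_step i T T2" "step5 i T2 T3" "step6 i T3 T'"
    using assms(1) by (auto simp: box_phase_def)
  have "(\<lambda>X Y. \<exists>f. (\<exists>(N, A)\<in>X. \<exists>c\<in>A. lbox_at i f c) \<and> lbox_step i f X Y)\<^sup>*\<^sup>* T3 T'"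
    using ph(3) by (auto simp: step6_def)
  then have "all_closable T3"
    using assms(2) by (induction rule: converse_rtranclp_induct) (use all_closable_lbox_step in blast)+
  have "(\<lambda>X Y. \<exists>f. (\<exists>(N, A)\<in>X. \<exists>c\<in>A. rbox_at i f c) \<and> rbox_step i f X Y)\<^sup>*\<^sup>* T2 T3"
    using ph(2) by (auto simp: step5_def)
  then have "all_closable T2"
    using \<open>all_closable T3\<close> by (induction rule: converse_rtranclp_induct) (use all_closable_rbox_step in blast)+
  then show ?thesis using all_closable_ex_step[OF ph(1)] by blast
qed (use assms in blast)

lemma closed_complete_tab_derivable:
  assumes "closed_complete_tab f" shows "lk_derivable f"
proof -
  obtain T where T: "lkp_run f T" "\<forall>(N, A)\<in>T. branch_closed lkp_isv N"
    using assms by (auto simp: closed_complete_tab_def complete_tab_def)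
  have "all_closable T" using T(2) simulates_closed lk_closable.closed by fast
  with T(1) have "all_closable (root_state f)"
  proof (induction rule: lkp_run.induct)
    case (step T T1 T')
    have "all_closable T1" using step all_closable_box_phase by blast
    with \<open>p_step\<^sup>*\<^sup>* T T1\<close> have "all_closable T"
      by (induction rule: converse_rtranclp_induct) (use all_closable_p_step in blast)+
    then show ?case using step by blast
  qed
  moreover have "simulates (\<lambda>i. i) {Ineq {#} Gt {#(f, 1)#}, Rel 1 2}
    ({Ineq {#} Gt {#(map_fm OV f, 1)#}, Rel 1 2}, {Ineq {#} Gt {#(map_fm OV f, 1)#}})"
    by (auto simp: simulates_def)
  ultimately show ?thesis by (auto simp: root_state_def intro!: lk_closable_derivable)
qed

section \<open>Termination of the LK'(A) procedure\<close>

lemma image_mset_set_less: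
  fixes m :: "'b \<Rightarrow> 'c :: preorder"
  assumes "finite A" "P \<subseteq> A" "P \<noteq> {}" "finite C" and "\<And>c. c \<in> C \<Longrightarrow> \<exists>p\<in>P. m c < m p"
  shows "image_mset m (mset_set (A - P \<union> C)) < image_mset m (mset_set A)"
proof -
  \<comment> \<open>Branches and states are sets, so a conclusion that is already present must not
    be counted twice.\<close>
  define K where "K = C - (A - P)"
  have fin: "finite (A - P)" "finite K" "finite P" using assms finite_subset by (auto simp: K_def)
  have "mset_set (A - P \<union> C) = mset_set (A - P) + mset_set K"
    using mset_set_Union[of "A - P" K] fin by (auto simp: K_def)
  moreover have "mset_set A = mset_set (A - P) + mset_set P"
    using mset_set_Union[of "A - P" P] fin assms(2) by (simp add: Un_absorb2 Diff_partition Int_commute)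
  moreover have "multp (<) (image_mset m (mset_set (A - P)) + image_mset m (mset_set K))
     (image_mset m (mset_set (A - P)) + image_mset m (mset_set P))"
    using assms fin by (intro one_step_implies_multp) (auto simp: mset_set_empty_iff K_def)
  ultimately show ?thesis by (simp add: less_multiset_def)
qed

text \<open>Meant for (ex), which leaves active inequations alone: \<open>h\<close> may merge
  branches, and restricting it to a set of representatives on which it is injective shows that
  merging only removes elements.\<close>

lemma image_mset_set_image_le:
  fixes m :: "'b \<Rightarrow> 'c :: preorder"
  assumes "finite T" "\<And>b. b \<in> T \<Longrightarrow> m (h b) = m b"
  shows "image_mset m (mset_set (h ` T)) \<le> image_mset m (mset_set T)"
proof -
  obtain S where S: "S \<subseteq> T" "inj_on h S" "h ` T = h ` S"
    using subset_image_inj[of "h ` T" h T] by auto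
  have "image_mset m (mset_set (h ` T)) = image_mset m (image_mset h (mset_set S))"
    using S by (simp add: image_mset_mset_set)
  also have "\<dots> = image_mset m (mset_set S)"
    unfolding multiset.map_comp using assms S(1) finite_subset[OF S(1) assms(1)] by (intro image_mset_cong) auto
  also have "\<dots> \<le> image_mset m (mset_set T)"
    using S(1) assms(1) by (intro subset_eq_imp_le_multiset image_mset_subseteq_mono subset_imp_msubset_mset_set)
  finally show ?thesis .
qed

definition branch_size :: "'a node set \<times> 'a node set \<Rightarrow> nat multiset" where
  "branch_size b = image_mset ineq_cpx (mset_set (snd b))"

text \<open>Two nested multiset orders: a rule replaces an inequation by several smaller ones, and
  branching replaces a branch by several smaller branches.\<close>

definition state_size :: "'a state \<Rightarrow> nat multiset multiset" where
  "state_size T = image_mset branch_size (mset_set T)"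

definition fin_branch :: "'a node set \<times> 'a node set \<Rightarrow> bool" where
  "fin_branch b \<longleftrightarrow> finite (fst b) \<and> snd b \<subseteq> fst b"

abbreviation fin_state :: "'a state \<Rightarrow> bool" where
  "fin_state T \<equiv> finite T \<and> (\<forall>b\<in>T. fin_branch b)"

lemma fin_branch_active: "fin_branch (N, A) \<Longrightarrow> finite A"
  by (auto simp: fin_branch_def intro: finite_subset)

lemma branch_size_less:
  assumes "fin_branch (N, A)" "P \<subseteq> A" "P \<noteq> {}" "finite C"
    and "\<And>c. c \<in> C \<Longrightarrow> \<exists>p\<in>P. ineq_cpx c < ineq_cpx p"
  shows "branch_size (N', A - P \<union> C) < branch_size (N, A)"
  unfolding branch_size_def snd_conv
  by (rule image_mset_set_less[OF fin_branch_active[OF assms(1)]]) (use assms in auto)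

lemma ineq_cpx_Ineq: "ineq_cpx (Ineq G r D) = (\<Sum>x\<in>#G. cpx (fst x)) + (\<Sum>x\<in>#D. cpx (fst x))"
  by (simp add: ineq_cpx_def o_def)

lemma prop_rule_cpx: "prop_rule c alts \<Longrightarrow> C \<in> set alts \<Longrightarrow> c' \<in> C \<Longrightarrow> ineq_cpx c' < ineq_cpx c"
  by (induction rule: prop_rule.induct) (auto simp: ineq_cpx_Ineq)

lemma filter_replicate_mset: "M = filter_mset (\<lambda>z. z \<noteq> x) M + replicate_mset (count M x) x"
  by (rule multiset_eqI) auto

lemma repl_cpx:
  assumes "(Box f, i) \<in># M"
  shows "(\<Sum>x\<in>#repl (Box f, i) (At q, i) M. cpx (fst x)) < (\<Sum>x\<in>#M. cpx (fst x))"
proof -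
  have "(\<Sum>x\<in>#M. cpx (fst x)) = (\<Sum>x\<in>#filter_mset (\<lambda>z. z \<noteq> (Box f, i)) M. cpx (fst x)) + count M (Box f, i) * Suc (cpx f)"
    using arg_cong[OF filter_replicate_mset[of M "(Box f, i)"], of "\<lambda>M. \<Sum>x\<in>#M. cpx (fst x)"]
    by (simp only: image_mset_union sum_mset.union image_replicate_mset sum_mset_replicate_mset) simp
  moreover have "(\<Sum>x\<in>#repl (Box f, i) (At q, i) M. cpx (fst x)) = (\<Sum>x\<in>#filter_mset (\<lambda>z. z \<noteq> (Box f, i)) M. cpx (fst x))"
    unfolding repl_def by simp
  moreover have "count M (Box f, i) > 0" using assms by simp
  ultimately show ?thesis by simp
qed

lemma cpx_member_le: "x \<in># M \<Longrightarrow> cpx (fst x) \<le> (\<Sum>x\<in>#M. cpx (fst x))"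
  by (auto dest!: multi_member_split)

text \<open>The second bound concerns the new inequation between \<open>[Box f]\<close> and
  \<open>f\<close>, whose complexity is just \<open>cpx f\<close>.\<close>

lemma rbox_at_cpx:
  assumes "rbox_at i f c"
  shows "ineq_cpx (rconc i f c) < ineq_cpx c" "cpx f < ineq_cpx c"
proof -
  obtain G r D where c: "c = Ineq G r D" "(Box f, i) \<in># D" using assms by (auto simp: rbox_at_def)
  then show "ineq_cpx (rconc i f c) < ineq_cpx c" "cpx f < ineq_cpx c"
    using repl_cpx[of f i D "BV f"] cpx_member_le[of "(Box f, i)" D] by (simp_all add: ineq_cpx_Ineq)
qed

lemma lbox_at_cpx:
  assumes "lbox_at i f c"
  shows "ineq_cpx (lconc i f c) < ineq_cpx c" "cpx f < ineq_cpx c"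
proof -
  obtain G r D where c: "c = Ineq G r D" "(Box f, i) \<in># G" using assms by (auto simp: lbox_at_def)
  then show "ineq_cpx (lconc i f c) < ineq_cpx c" "cpx f < ineq_cpx c"
    using repl_cpx[of f i G "BV f"] cpx_member_le[of "(Box f, i)" G] by (simp_all add: ineq_cpx_Ineq)
qed

text \<open>Branches that do not shrink are fixed by \<open>h\<close>, so the step amounts to
  removing the set \<open>P\<close> of shrinking branches and adding smaller ones.\<close>

lemma fin_state_image:
  assumes "fin_state T" "\<forall>b\<in>T. fin_branch (h b) \<and> (h b = b \<or> branch_size (h b) < branch_size b)"
    "\<exists>b\<in>T. branch_size (h b) < branch_size b"
  shows "fin_state (h ` T) \<and> state_size (h ` T) < state_size T"
proof -
  define P where "P = {b\<in>T. branch_size (h b) < branch_size b}"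
  have "h ` (T - P) = T - P" using assms(2) by (force simp: P_def)
  then have "h ` T = T - P \<union> h ` P" unfolding P_def by auto
  moreover have "image_mset branch_size (mset_set (T - P \<union> h ` P)) < image_mset branch_size (mset_set T)"
  proof (rule image_mset_set_less)
    fix c assume "c \<in> h ` P"
    then show "\<exists>p\<in>P. branch_size c < branch_size p" by (auto simp: P_def)
  qed (use assms in \<open>auto simp: P_def\<close>)
  ultimately have "state_size (h ` T) < state_size T" by (simp add: state_size_def)
  then show ?thesis using assms(1,2) by blast
qed

lemma p_step_decreases:
  assumes "fin_state T" "(N, A) \<in> T" "c \<in> A" "prop_rule c alts"
  shows "\<exists>T'. p_step T T' \<and> fin_state T' \<and> state_size T' < state_size T"
proof -
  define C where "C = (\<lambda>C. (N \<union> C, (A - {c}) \<union> C)) ` set alts"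
  have fb: "fin_branch (N, A)" using assms by auto
  have C: "fin_branch b \<and> branch_size b < branch_size (N, A)" if "b \<in> C" for b
  proof -
    obtain D where D: "D \<in> set alts" "b = (N \<union> D, (A - {c}) \<union> D)" using \<open>b \<in> C\<close> by (auto simp: C_def)
    have "branch_size b < branch_size (N, A)" unfolding D(2)
      using fb assms(3) prop_rule_finite[OF assms(4) D(1)] prop_rule_cpx[OF assms(4) D(1)]
      by (intro branch_size_less) auto
    moreover have "fin_branch b" using fb prop_rule_finite[OF assms(4) D(1)] by (auto simp: D fin_branch_def)
    ultimately show ?thesis by blast
  qed
  have "state_size ((T - {(N, A)}) \<union> C) < state_size T" unfolding state_size_def
    by (rule image_mset_set_less) (use assms C in \<open>auto simp: C_def\<close>)
  moreover have "p_step T ((T - {(N, A)}) \<union> C)" using assms unfolding p_step_def C_def by blast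
  moreover have "fin_state ((T - {(N, A)}) \<union> C)" using assms(1) C by (auto simp: C_def)
  ultimately show ?thesis by blast
qed

section \<open>Each phase of the procedure can be carried out\<close>

lemma prop_phase_exists:
  "fin_state T \<Longrightarrow> \<exists>T'. p_step\<^sup>*\<^sup>* T T' \<and> prop_done T' \<and> fin_state T' \<and> state_size T' \<le> state_size T"
proof (induction "state_size T" arbitrary: T rule: less_induct)
  case less
  show ?case
  proof (cases "prop_done T")
    case True
    then show ?thesis using less.prems by blast
  next
    case False
    then obtain N A c alts where "(N, A) \<in> T" "c \<in> A" "prop_rule c alts" by (auto simp: prop_done_def)
    from p_step_decreases[OF less.prems this] obtain T1 where
      T1: "p_step T T1" "fin_state T1" "state_size T1 < state_size T" by blast
    from less.hyps[OF T1(3,2)] obtain T' where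
      "p_step\<^sup>*\<^sup>* T1 T'" "prop_done T'" "fin_state T'" "state_size T' \<le> state_size T1" by blast
    moreover from this T1(3) have "state_size T' \<le> state_size T" by order
    ultimately show ?thesis using converse_rtranclp_into_rtranclp[of p_step, OF T1(1)] by blast
  qed
qed

lemma rbox_branch_exists:
  assumes "fin_branch b"
  shows "\<exists>b'. rbox_branch i f b b' \<and> fin_branch b' \<and> (b' = b \<or> branch_size b' < branch_size b) \<and>
    ((\<exists>c\<in>snd b. rbox_at i f c) \<longrightarrow> branch_size b' < branch_size b)"
proof -
  obtain N A where b: "b = (N, A)" by (cases b)
  define P where "P = {c\<in>A. rbox_at i f c}"
  show ?thesis
  proof (cases "P = {}")
    case True
    then show ?thesis using assms by (intro exI[of _ b]) (auto simp: rbox_branch_def b P_def)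
  next
    case False
    obtain j where j: "fresh j N" using assms fresh_exists by (auto simp: fin_branch_def b)
    define e :: "'a vs node" where "e = Ineq {#(At (BV f), i)#} Ge {#(f, j)#}"
    define b' where "b' = (N \<union> {e, Rel i j} \<union> rconc i f ` P, (A - P) \<union> {e} \<union> rconc i f ` P)"
    have "finite P" using fin_branch_active[OF assms[unfolded b]] by (simp add: P_def)
    have "ineq_cpx e = cpx f" by (simp add: e_def ineq_cpx_Ineq)
    then have "\<exists>p\<in>P. ineq_cpx c < ineq_cpx p" if "c \<in> {e} \<union> rconc i f ` P" for c
      using that False rbox_at_cpx[of i f] unfolding P_def by fastforce
    then have "branch_size b' < branch_size b"
      using assms False \<open>finite P\<close> unfolding b b'_def Un_assoc
      by (intro branch_size_less) (auto simp: P_def)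
    moreover have "rbox_branch i f b b'" using False j
      unfolding rbox_branch_def b b'_def Let_def fst_conv snd_conv P_def[symmetric] e_def by (simp only: if_False) blast
    moreover have "fin_branch b'" using assms \<open>finite P\<close> by (auto simp: fin_branch_def b b'_def)
    ultimately show ?thesis by blast
  qed
qed

text \<open>There is one new inequation per successor of \<open>i\<close>, a number not bounded by
  the premises; the multiset order tolerates this, a sum of complexities would not.\<close>

lemma lbox_branch_exists:
  assumes "fin_branch b"
  shows "\<exists>b'. lbox_branch i f b b' \<and> fin_branch b' \<and> (b' = b \<or> branch_size b' < branch_size b) \<and>
    ((\<exists>c\<in>snd b. lbox_at i f c) \<longrightarrow> branch_size b' < branch_size b)"
proof -
  obtain N A where b: "b = (N, A)" by (cases b)
  define P where "P = {c\<in>A. lbox_at i f c}"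
  show ?thesis
  proof (cases "P = {}")
    case True
    then show ?thesis using assms by (intro exI[of _ b]) (auto simp: lbox_branch_def b P_def)
  next
    case False
    define E :: "'a vs node set" where "E = {Ineq {#(f, j)#} Ge {#(At (BV f), i)#} | j. Rel i j \<in> N}"
    define b' where "b' = (N \<union> E \<union> lconc i f ` P, (A - P) \<union> E \<union> lconc i f ` P)"
    have "finite P" using fin_branch_active[OF assms[unfolded b]] by (simp add: P_def)
    have "finite E" using assms finite_successors[of N i] by (auto simp: E_def fin_branch_def b)
    have E: "ineq_cpx e = cpx f" if "e \<in> E" for e using that by (auto simp: E_def ineq_cpx_Ineq)
    have "\<exists>p\<in>P. ineq_cpx c < ineq_cpx p" if "c \<in> E \<union> lconc i f ` P" for c
      using that False lbox_at_cpx[of i f] E unfolding P_def by fastforce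
    then have "branch_size b' < branch_size b"
      using assms False \<open>finite P\<close> \<open>finite E\<close> unfolding b b'_def Un_assoc
      by (intro branch_size_less) (auto simp: P_def)
    moreover have "lbox_branch i f b b'" using False
      unfolding lbox_branch_def b b'_def Let_def fst_conv snd_conv P_def[symmetric] E_def by (simp only: if_False)
    moreover have "fin_branch b'" using assms \<open>finite P\<close> \<open>finite E\<close> by (auto simp: fin_branch_def b b'_def)
    ultimately show ?thesis by blast
  qed
qed

lemma rbox_step_decreases:
  assumes "fin_state T" "\<exists>(N, A)\<in>T. \<exists>c\<in>A. rbox_at i f c"
  shows "\<exists>T'. rbox_step i f T T' \<and> fin_state T' \<and> state_size T' < state_size T"
proof -
  have "\<forall>b\<in>T. \<exists>b'. rbox_branch i f b b' \<and> fin_branch b' \<and> (b' = b \<or> branch_size b' < branch_size b) \<and>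
      ((\<exists>c\<in>snd b. rbox_at i f c) \<longrightarrow> branch_size b' < branch_size b)"
    (is "\<forall>b\<in>T. \<exists>b'. ?Q b b'") using assms(1) by (intro ballI rbox_branch_exists) blast
  from bchoice[OF this] obtain h where h: "\<forall>b\<in>T. ?Q b (h b)" by blast
  moreover have "\<exists>b\<in>T. branch_size (h b) < branch_size b" using assms(2) h by fastforce
  ultimately have "fin_state (h ` T) \<and> state_size (h ` T) < state_size T" using fin_state_image assms(1) by blast
  then show ?thesis using h unfolding rbox_step_iff by blast
qed

lemma lbox_step_decreases:
  assumes "fin_state T" "\<exists>(N, A)\<in>T. \<exists>c\<in>A. lbox_at i f c"
  shows "\<exists>T'. lbox_step i f T T' \<and> fin_state T' \<and> state_size T' < state_size T"
proof -
  have "\<forall>b\<in>T. \<exists>b'. lbox_branch i f b b' \<and> fin_branch b' \<and> (b' = b \<or> branch_size b' < branch_size b) \<and>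
      ((\<exists>c\<in>snd b. lbox_at i f c) \<longrightarrow> branch_size b' < branch_size b)"
    (is "\<forall>b\<in>T. \<exists>b'. ?Q b b'") using assms(1) by (intro ballI lbox_branch_exists) blast
  from bchoice[OF this] obtain h where h: "\<forall>b\<in>T. ?Q b (h b)" by blast
  moreover have "\<exists>b\<in>T. branch_size (h b) < branch_size b" using assms(2) h by fastforce
  ultimately have "fin_state (h ` T) \<and> state_size (h ` T) < state_size T" using fin_state_image assms(1) by blast
  then show ?thesis using h unfolding lbox_step_iff by blast
qed

lemma step5_exists:
  "fin_state T \<Longrightarrow> \<exists>T'. step5 i T T' \<and> fin_state T' \<and> (T' = T \<or> state_size T' < state_size T)"
proof (induction "state_size T" arbitrary: T rule: less_induct)
  case less
  show ?case
  proof (cases "\<exists>f. \<exists>(N, A)\<in>T. \<exists>c\<in>A. rbox_at i f c")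
    case False
    then have "step5 i T T" unfolding step5_def by fast
    then show ?thesis using less.prems by blast
  next
    case True
    then obtain f where f: "\<exists>(N, A)\<in>T. \<exists>c\<in>A. rbox_at i f c" by blast
    from rbox_step_decreases[OF less.prems f] obtain T1 where
      T1: "rbox_step i f T T1" "fin_state T1" "state_size T1 < state_size T" by blast
    from less.hyps[OF T1(3,2)] obtain T' where
      T': "step5 i T1 T'" "fin_state T'" "T' = T1 \<or> state_size T' < state_size T1" by blast
    have "step5 i T T'" using T'(1) f T1(1) unfolding step5_def
      by (intro conjI converse_rtranclp_into_rtranclp[of _ T T1]) blast+
    then show ?thesis using T' T1(3) by auto
  qed
qed

lemma step6_exists:
  "fin_state T \<Longrightarrow> \<exists>T'. step6 i T T' \<and> fin_state T' \<and> (T' = T \<or> state_size T' < state_size T)"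
proof (induction "state_size T" arbitrary: T rule: less_induct)
  case less
  show ?case
  proof (cases "\<exists>f. \<exists>(N, A)\<in>T. \<exists>c\<in>A. lbox_at i f c")
    case False
    then have "step6 i T T" unfolding step6_def by fast
    then show ?thesis using less.prems by blast
  next
    case True
    then obtain f where f: "\<exists>(N, A)\<in>T. \<exists>c\<in>A. lbox_at i f c" by blast
    from lbox_step_decreases[OF less.prems f] obtain T1 where
      T1: "lbox_step i f T T1" "fin_state T1" "state_size T1 < state_size T" by blast
    from less.hyps[OF T1(3,2)] obtain T' where
      T': "step6 i T1 T'" "fin_state T'" "T' = T1 \<or> state_size T' < state_size T1" by blast
    have "step6 i T T'" using T'(1) f T1(1) unfolding step6_def
      by (intro conjI converse_rtranclp_into_rtranclp[of _ T T1]) blast+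
    then show ?thesis using T' T1(3) by auto
  qed
qed

lemma ex_branch_exists:
  assumes "fin_branch b"
  shows "\<exists>b'. ex_branch i b b' \<and> fin_branch b' \<and> snd b' = snd b"
proof (cases "has_box i (snd b)")
  case True
  obtain k where "fresh k (fst b)" using assms fresh_exists by (auto simp: fin_branch_def)
  then have "ex_branch i b (fst b \<union> {Rel i k}, snd b)" using True unfolding ex_branch_def by (simp only: if_True) blast
  then show ?thesis using assms by (auto simp: fin_branch_def)
next
  case False
  then have "ex_branch i b b" unfolding ex_branch_def by (simp only: if_False)
  then show ?thesis using assms by blast
qed

lemma box_phase_exists:
  assumes "fin_state T" "box_in i T"
  shows "\<exists>T'. box_phase T T' \<and> fin_state T' \<and> state_size T' < state_size T"
proof -
  have "\<forall>b\<in>T. \<exists>b'. ex_branch i b b' \<and> fin_branch b' \<and> snd b' = snd b"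
    (is "\<forall>b\<in>T. \<exists>b'. ?Q b b'") using assms(1) by (intro ballI ex_branch_exists) blast
  from bchoice[OF this] obtain h where h: "\<forall>b\<in>T. ?Q b (h b)" by blast
  define T2 where "T2 = h ` T"
  have ex: "ex_step i T T2" using h unfolding ex_step_iff T2_def by blast
  have T2: "fin_state T2" using h assms(1) by (auto simp: T2_def)
  have le: "state_size T2 \<le> state_size T" unfolding state_size_def T2_def
    by (rule image_mset_set_image_le) (use h assms(1) in \<open>auto simp: branch_size_def\<close>)
  obtain T3 where T3: "step5 i T2 T3" "fin_state T3" "T3 = T2 \<or> state_size T3 < state_size T2"
    using step5_exists[OF T2] by blast
  obtain T4 where T4: "step6 i T3 T4" "fin_state T4" "T4 = T3 \<or> state_size T4 < state_size T3"
    using step6_exists[OF T3(2)] by blast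
  have "box_in i T2" using assms(2) h unfolding box_in_def T2_def split_def by auto
  \<comment> \<open>(ex) does not shrink the state, so the decrease must come from step 5 or 6: if
    both were idle, no box labelled \<open>i\<close> could have been there.\<close>
  moreover have "\<not> box_in i T2" if "T3 = T2" "T4 = T3"
    using T3(1) T4(1) unfolding that box_in_def step5_def step6_def split_def by blast
  ultimately have "state_size T4 < state_size T" using T3(3) T4(3) le by auto
  moreover have "box_phase T T4" using assms(2) ex T3(1) T4(1) unfolding box_phase_def by blast
  ultimately show ?thesis using T4 by blast
qed

lemma prop_rule_applicable:
  assumes "(g, i) \<in># G + D" "cpx g > 0" "\<And>h. g \<noteq> Box h"
  shows "\<exists>alts. prop_rule (Ineq G r D) alts"
proof -
  consider G' where "G = G' + {#(g, i)#}" | D' where "D = D' + {#(g, i)#}"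
    using assms(1) by (auto dest!: multi_member_split)
  then show ?thesis
    by cases (cases g; insert assms(2,3); simp; blast intro: prop_rule.intros[simplified])+
qed

lemma all_zero_no_box:
  assumes "prop_done T" "\<not> (\<exists>i. box_in i T)" shows "all_zero T"
proof -
  have "ineq_cpx c = 0" if NA: "(N, A) \<in> T" "c \<in> A" for N A c
  proof (cases c)
    case (Ineq G r D)
    have "cpx g = 0" if g: "(g, i) \<in># G + D" for g i
    proof (rule ccontr)
      assume "cpx g \<noteq> 0"
      moreover have "g \<noteq> Box h" for h
        using assms(2) NA Ineq g unfolding box_in_def rbox_at_def lbox_at_def by fastforce
      ultimately show False
        using prop_rule_applicable[OF g] assms(1) NA Ineq unfolding prop_done_def by fastforce
    qed
    then show ?thesis using Ineq by (fastforce simp: ineq_cpx_Ineq)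
  qed (simp add: ineq_cpx_def)
  then show ?thesis by (auto simp: all_zero_def)
qed

lemma lkp_run_completes:
  "lkp_run f T \<Longrightarrow> fin_state T \<Longrightarrow> \<exists>T'. complete_tab f T'"
proof (induction "state_size T" arbitrary: T rule: less_induct)
  case less
  show ?case
  proof (cases "all_zero T")
    case True
    then show ?thesis using less.prems by (auto simp: complete_tab_def)
  next
    case False
    obtain T1 where T1: "p_step\<^sup>*\<^sup>* T T1" "prop_done T1" "fin_state T1" "state_size T1 \<le> state_size T"
      using prop_phase_exists[OF less.prems(2)] by blast
    show ?thesis
    proof (cases "\<exists>i. box_in i T1")
      case True
      then obtain T' where T': "box_phase T1 T'" "fin_state T'" "state_size T' < state_size T1"
        using box_phase_exists[OF T1(3)] by blast
      have "state_size T' < state_size T" using T'(3) T1(4) by (rule order_less_le_trans)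
      then show ?thesis using less.hyps lkp_run.step[OF less.prems(1) False T1(1,2) T'(1)] T'(2) by blast
    next
      case nobox: False
      \<comment> \<open>The state need not shrink here, but it is final: with neither propositional
        rules nor boxes left, all complexities are 0.\<close>
      then have "box_phase T1 T1" by (simp add: box_phase_def)
      then show ?thesis
        using lkp_run.step[OF less.prems(1) False T1(1,2)] all_zero_no_box[OF T1(2) nobox]
        unfolding complete_tab_def by blast
    qed
  qed
qed

lemma complete_tab_exists: "\<exists>T. complete_tab f T"
  by (rule lkp_run_completes[OF lkp_run.init]) (auto simp: root_state_def fin_branch_def)

section \<open>Countermodels from open branches\<close>

fun node_true :: "('a lf \<Rightarrow> real) \<Rightarrow> 'a node \<Rightarrow> bool" where
  "node_true a (Ineq G r D) \<longleftrightarrow> holds r (msum a G) (msum a D)"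
| "node_true a (Rel i j) \<longleftrightarrow> True"

abbreviation true_in :: "(nat \<times> nat) set \<Rightarrow> ('a \<Rightarrow> nat \<Rightarrow> real) \<Rightarrow> 'a node \<Rightarrow> bool" where
  "true_in R v \<equiv> node_true (lval R v (\<lambda>i. i))"

lemma holds_mono: "holds r x y \<Longrightarrow> x \<le> x' \<Longrightarrow> y' \<le> y \<Longrightarrow> holds r x' y'"
  by (cases r) auto

text \<open>With two conclusions in one alternative, the min or max is attained by one of them; for
  a branching rule, either alternative alone bounds the premise.\<close>

lemma prop_rule_backward:
  assumes "prop_rule c alts" "C \<in> set alts" "\<forall>c'\<in>C. true_in R v c'"
  shows "true_in R v c"
  using assms
proof (induction rule: prop_rule.induct)
  case (il G f g i r D)
  then show ?case by (cases r) auto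
next
  case (ir G r D f g i)
  then show ?case by (cases r) auto
qed (auto simp: min_def max_def add.assoc elim!: holds_mono split: if_splits)

lemma msum_repl: "msum a (repl x y M) = msum a M + of_nat (count M x) * (a y - a x)"
proof -
  have "msum a M = msum a (filter_mset (\<lambda>z. z \<noteq> x) M) + of_nat (count M x) * a x"
    using arg_cong[OF filter_replicate_mset[of M x], of "msum a"]
    by (simp only: image_mset_union sum_mset.union image_replicate_mset sum_mset_replicate_mset)
  then show ?thesis unfolding repl_def by (simp add: algebra_simps)
qed

text \<open>A term on the right may only be lowered and one on the left only raised, hence the
  opposite bounds on \<open>[Box f]\<close> here and in \<open>lconc_backward\<close>.\<close>

lemma rconc_backward:
  assumes "true_in R v (rconc i f c)" "eval R v (Box f) i \<le> v (BV f) i"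
  shows "true_in R v c"
proof (cases c)
  case (Ineq G r D)
  have "msum (lval R v (\<lambda>i. i)) D \<le> msum (lval R v (\<lambda>i. i)) (repl (Box f, i) (At (BV f), i) D)"
    using assms(2) by (simp add: msum_repl del: eval.simps(7))
  then show ?thesis using assms(1) Ineq by (auto elim: holds_mono)
qed simp

lemma lconc_backward:
  assumes "true_in R v (lconc i f c)" "v (BV f) i \<le> eval R v (Box f) i"
  shows "true_in R v c"
proof (cases c)
  case (Ineq G r D)
  have "msum (lval R v (\<lambda>i. i)) (repl (Box f, i) (At (BV f), i) G) \<le> msum (lval R v (\<lambda>i. i)) G"
    using assms(2) by (simp add: msum_repl mult_nonneg_nonpos del: eval.simps(7))
  then show ?thesis using assms(1) Ineq by (auto elim: holds_mono)
qed simp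

lemma finite_successors_rel: "finite R \<Longrightarrow> finite {y. (x, y) \<in> R}"
  by (rule finite_subset[of _ "snd ` R"]) force+

lemma eval_Box_le:
  assumes "finite R" "(x, y) \<in> R" shows "eval R v (Box f) x \<le> eval R v f y"
  using assms finite_successors_rel[OF assms(1), of x] by (auto intro!: cInf_lower)

text \<open>The edge to \<open>y\<close> is what (ex) provides: without successors the box would
  have value 0, whatever \<open>z\<close> is.\<close>

lemma eval_Box_ge:
  assumes "(x, y) \<in> R" "\<And>y. (x, y) \<in> R \<Longrightarrow> z \<le> eval R v f y"
  shows "z \<le> eval R v (Box f) x"
  using assms by (auto intro!: cInf_greatest)

section \<open>Invariants of the procedure\<close>

definition live :: "'a node set \<Rightarrow> nat set" where
  "live A = {i. \<exists>c\<in>A. \<exists>g. (g, i) \<in> lfs c \<and> cpx g > 0}"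

abbreviation has_succ :: "'a node set \<Rightarrow> nat \<Rightarrow> bool" where
  "has_succ N i \<equiv> \<exists>j. Rel i j \<in> N"

context
  fixes root :: "'v vs node"
begin

text \<open>Truth is evaluated over any finite relation that may still grow at labels outside \<open>X\<close>:
  no later step of the procedure adds successors to a label in \<open>X\<close>.\<close>

definition justified :: "nat set \<Rightarrow> 'v vs node set \<Rightarrow> 'v vs node set \<Rightarrow> bool" where
  "justified X N A \<longleftrightarrow> (\<forall>R v. finite R \<longrightarrow> (\<forall>i j. Rel i j \<in> N \<longrightarrow> (i, j) \<in> R) \<longrightarrow>
     (\<forall>i\<in>X. \<forall>j. (i, j) \<in> R \<longrightarrow> Rel i j \<in> N) \<longrightarrow> (\<forall>c\<in>A. true_in R v c) \<longrightarrow> true_in R v root)"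

lemma justified_mono: "justified X N A \<Longrightarrow> X \<subseteq> Y \<Longrightarrow> justified Y N A"
  unfolding justified_def by blast

text \<open>Settled labels stay settled and get no new edges, so a relation admissible after the
  step was admissible before it. Only the local implication from \<open>A'\<close> to
  \<open>A\<close> remains.\<close>

lemma justified_step:
  assumes "justified X N A" "X \<subseteq> X'" "N \<subseteq> N'" "\<And>i j. i \<in> X \<Longrightarrow> Rel i j \<in> N' \<Longrightarrow> Rel i j \<in> N"
    and "\<And>R v c. finite R \<Longrightarrow> (\<And>i j. Rel i j \<in> N' \<Longrightarrow> (i, j) \<in> R) \<Longrightarrow>
      (\<And>i j. i \<in> X' \<Longrightarrow> (i, j) \<in> R \<Longrightarrow> Rel i j \<in> N') \<Longrightarrow> (\<And>c. c \<in> A' \<Longrightarrow> true_in R v c) \<Longrightarrow>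
      c \<in> A \<Longrightarrow> true_in R v c"
  shows "justified X' N' A'"
  unfolding justified_def
proof (intro allI impI)
  fix R v
  assume R: "finite R" "\<forall>i j. Rel i j \<in> N' \<longrightarrow> (i, j) \<in> R" "\<forall>i\<in>X'. \<forall>j. (i, j) \<in> R \<longrightarrow> Rel i j \<in> N'"
    and A': "\<forall>c\<in>A'. true_in R v c"
  have "\<forall>c\<in>A. true_in R v c" using assms(5)[of R v] R A' by blast
  moreover have "\<forall>i\<in>X. \<forall>j. (i, j) \<in> R \<longrightarrow> Rel i j \<in> N" using R(3) assms(2,4) by blast
  moreover have "\<forall>i j. Rel i j \<in> N \<longrightarrow> (i, j) \<in> R" using R(2) assms(3) by blast
  ultimately show "true_in R v root" using assms(1) R(1) unfolding justified_def by blast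
qed

text \<open>Settled labels are those that are not live but have a successor; a leaf is not settled,
  since processing its predecessor may wake it. Successors of a live label are leaves, so waking
  them never unsettles a label; they are not live, so a label is processed only after its
  predecessor. Unique predecessors keep these conditions independent for different labels. The edge
  from 1 to 2 is why a live label may have a successor at all.\<close>

definition good_branch :: "'v vs node set \<times> 'v vs node set \<Rightarrow> bool" where
  "good_branch b \<longleftrightarrow> (case b of (N, A) \<Rightarrow> finite N \<and> A \<subseteq> N \<and>
     (\<forall>i i' j. Rel i j \<in> N \<longrightarrow> Rel i' j \<in> N \<longrightarrow> i = i') \<and>
     (\<forall>i j. i \<in> live A \<longrightarrow> Rel i j \<in> N \<longrightarrow> j \<notin> live A \<and> \<not> has_succ N j) \<and>
     justified {i. i \<notin> live A \<and> has_succ N i} N A)"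

text \<open>The invariant while label \<open>i\<close> is being processed; \<open>q\<close> tells whether all successors of \<open>i\<close> have
  been created.\<close>

definition busy_branch :: "bool \<Rightarrow> nat \<Rightarrow> 'v vs node set \<times> 'v vs node set \<Rightarrow> bool" where
  "busy_branch q i b \<longleftrightarrow> (case b of (N, A) \<Rightarrow> finite N \<and> A \<subseteq> N \<and>
     (\<forall>l l' j. Rel l j \<in> N \<longrightarrow> Rel l' j \<in> N \<longrightarrow> l = l') \<and>
     (\<forall>l j. l \<in> insert i (live A) \<longrightarrow> Rel l j \<in> N \<longrightarrow> j \<noteq> i \<and> \<not> has_succ N j \<and> (l \<noteq> i \<longrightarrow> j \<notin> live A)) \<and>
     (\<forall>c\<in>A. \<forall>g. (g, i) \<in> lfs c \<longrightarrow> cpx g = 0 \<or> (\<exists>h. g = Box h)) \<and> has_succ N i \<and>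
     justified {l. (if l = i then q else l \<notin> live A) \<and> has_succ N l} N A)"

lemma good_branchD:
  assumes "good_branch (N, A)"
  shows "finite N" "A \<subseteq> N" "\<And>i i' j. Rel i j \<in> N \<Longrightarrow> Rel i' j \<in> N \<Longrightarrow> i = i'"
    "\<And>i j. i \<in> live A \<Longrightarrow> Rel i j \<in> N \<Longrightarrow> j \<notin> live A \<and> \<not> has_succ N j"
    "justified {i. i \<notin> live A \<and> has_succ N i} N A"
  using assms unfolding good_branch_def by blast+

lemma busy_branchD:
  assumes "busy_branch q i (N, A)"
  shows "finite N" "A \<subseteq> N" "\<And>l l' j. Rel l j \<in> N \<Longrightarrow> Rel l' j \<in> N \<Longrightarrow> l = l'"
    "\<And>l j. l \<in> insert i (live A) \<Longrightarrow> Rel l j \<in> N \<Longrightarrow> j \<noteq> i \<and> \<not> has_succ N j \<and> (l \<noteq> i \<longrightarrow> j \<notin> live A)"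
    "\<And>c g. c \<in> A \<Longrightarrow> (g, i) \<in> lfs c \<Longrightarrow> cpx g = 0 \<or> (\<exists>h. g = Box h)" "has_succ N i"
    "justified {l. (if l = i then q else l \<notin> live A) \<and> has_succ N l} N A"
  using assms unfolding busy_branch_def by blast+

text \<open>Consequently propositional rules wake no label.\<close>

lemma prop_rule_lfs_live:
  assumes "prop_rule c alts" "C \<in> set alts" "c' \<in> C" "(g, i) \<in> lfs c'"
  shows "(g, i) \<in> lfs c \<or> (\<exists>h. (h, i) \<in> lfs c \<and> cpx h > 0)"
  using assms by (induction rule: prop_rule.induct) auto

lemma good_branch_p_step:
  assumes "good_branch (N, A)" "c \<in> A" "prop_rule c alts" "C \<in> set alts"
  shows "good_branch (N \<union> C, A - {c} \<union> C)"
proof -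
  note g = good_branchD[OF assms(1)]
  define A' where "A' = A - {c} \<union> C"
  have live: "live A' \<subseteq> live A"
    using prop_rule_lfs_live[OF assms(3,4)] assms(2) unfolding live_def A'_def by blast
  have noRel: "Rel i j \<notin> C" for i j using prop_rule_no_Rel[OF assms(3,4)] .
  have "finite C" using prop_rule_finite[OF assms(3,4)] .
  have "justified {i. i \<notin> live A' \<and> has_succ (N \<union> C) i} (N \<union> C) A'"
  proof (rule justified_step[OF g(5)])
    fix R v c' assume "\<And>c. c \<in> A' \<Longrightarrow> true_in R v c" "c' \<in> A"
    then show "true_in R v c'"
      using prop_rule_backward[OF assms(3,4), of R v] by (cases "c' = c") (auto simp: A'_def)
  qed (use live noRel in \<open>auto simp: A'_def\<close>)
  moreover have "\<forall>i j. i \<in> live A' \<longrightarrow> Rel i j \<in> N \<union> C \<longrightarrow> j \<notin> live A' \<and> \<not> has_succ (N \<union> C) j"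
    using g(4) live noRel by blast
  moreover have "\<forall>i i' j. Rel i j \<in> N \<union> C \<longrightarrow> Rel i' j \<in> N \<union> C \<longrightarrow> i = i'" using g(3) noRel by blast
  moreover have "finite (N \<union> C)" "A' \<subseteq> N \<union> C" using g(1,2) \<open>finite C\<close> by (auto simp: A'_def)
  ultimately show ?thesis unfolding good_branch_def A'_def[symmetric] prod.case by blast
qed

lemma box_at_lfs: "rbox_at i f c \<Longrightarrow> (Box f, i) \<in> lfs c" "lbox_at i f c \<Longrightarrow> (Box f, i) \<in> lfs c"
  by (auto simp: rbox_at_def lbox_at_def)

lemma busy_start:
  assumes "good_branch (N, A)" "has_box i A" "fresh k N" "\<forall>c\<in>A. \<not> (\<exists>alts. prop_rule c alts)"
  shows "busy_branch False i (N \<union> {Rel i k}, A)"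
proof -
  note g = good_branchD[OF assms(1)]
  obtain c f where c: "c \<in> A" "(Box f, i) \<in> lfs c" using assms(2) box_at_lfs by blast
  have i: "i \<in> live A" using c unfolding live_def by force
  have k: "k \<notin> labels c" if "c \<in> N" for c using assms(3) that by (auto simp: fresh_def)
  have "i \<in> labels c" using snd_lfs_labels[OF c(2)] by simp
  then have ki: "k \<noteq> i" using k g(2) c(1) by blast
  have kRel: "Rel l k \<notin> N" "Rel k l \<notin> N" for l using k by force+
  \<comment> \<open>Exhausting the propositional rules leaves only atoms and boxes at
    \<open>i\<close>; this is what lets the box rules finish \<open>i\<close> completely.\<close>
  have "cpx g = 0 \<or> (\<exists>h. g = Box h)" if c: "c \<in> A" "(g, i) \<in> lfs c" for c g
  proof (rule ccontr)
    assume g: "\<not> (cpx g = 0 \<or> (\<exists>h. g = Box h))"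
    obtain G r D where "c = Ineq G r D" using c(2) by (cases c) auto
    then show False using prop_rule_applicable[of g i G D r] g c assms(4) by auto
  qed
  moreover have "j \<noteq> i \<and> \<not> has_succ (N \<union> {Rel i k}) j \<and> (l \<noteq> i \<longrightarrow> j \<notin> live A)"
    if "l \<in> insert i (live A)" "Rel l j \<in> N \<union> {Rel i k}" for l j
    using that g(4)[of l j] i ki kRel by auto
  \<comment> \<open>Label \<open>i\<close> is live and hence not settled, so it may receive the edge
    to \<open>k\<close>.\<close>
  moreover have "justified {l. (if l = i then False else l \<notin> live A) \<and> has_succ (N \<union> {Rel i k}) l} (N \<union> {Rel i k}) A"
    by (rule justified_step[OF g(5)]) (use i in auto)
  moreover have "l = l'" if "Rel l j \<in> N \<union> {Rel i k}" "Rel l' j \<in> N \<union> {Rel i k}" for l l' j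
    using that g(3) kRel by auto
  ultimately show ?thesis using g(1,2) unfolding busy_branch_def prod.case by blast
qed

lemma lfs_rconc: "(g, l) \<in> lfs (rconc i f c) \<Longrightarrow> (g, l) \<in> lfs c \<or> cpx g = 0"
  by (cases c) (auto simp: repl_def split: if_splits)

lemma lfs_lconc: "(g, l) \<in> lfs (lconc i f c) \<Longrightarrow> (g, l) \<in> lfs c \<or> cpx g = 0"
  by (cases c) (auto simp: repl_def split: if_splits)

lemma Rel_notin_rconc: "(\<And>c. c \<in> P \<Longrightarrow> rbox_at i f c) \<Longrightarrow> Rel k l \<notin> rconc i f ` P"
  by (fastforce simp: rbox_at_def)

lemma Rel_notin_lconc: "(\<And>c. c \<in> P \<Longrightarrow> lbox_at i f c) \<Longrightarrow> Rel k l \<notin> lconc i f ` P"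
  by (fastforce simp: lbox_at_def)

lemma busy_rbox:
  assumes "busy_branch False i b" "rbox_branch i f b b'"
  shows "busy_branch False i b'"
proof -
  obtain N A where b: "b = (N, A)" by (cases b)
  note g = busy_branchD[OF assms(1)[unfolded b]]
  from assms(2)[unfolded b] show ?thesis
  proof (cases rule: rbox_branch_cases)
    case keep
    then show ?thesis using assms(1) b by simp
  next
    case (extend P j e)
    define N' A' where "N' = N \<union> {e, Rel i j} \<union> rconc i f ` P" and "A' = (A - P) \<union> {e} \<union> rconc i f ` P"
    have PA: "P \<subseteq> A" "finite P" using extend(1) g(1,2) by (auto intro: finite_subset)
    obtain c where c: "c \<in> A" "rbox_at i f c" using extend(1,2) by blast
    have j: "j \<notin> labels c" if "c \<in> N" for c using extend(3) that by (auto simp: fresh_def)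
    have ji: "j \<noteq> i" using j box_at_labels(1)[OF c(2)] g(2) c(1) by blast
    have jRel: "Rel l j \<notin> N" "Rel j l \<notin> N" for l using j by force+
    have Rels: "Rel l m \<in> N' \<longleftrightarrow> Rel l m \<in> N \<or> l = i \<and> m = j" for l m
      using extend(1) Rel_notin_rconc[of P i f l m] by (auto simp: N'_def extend(4))
    have lfs': "(\<exists>c\<in>A. (h, l) \<in> lfs c) \<or> cpx h = 0 \<or> l = j" if hl: "(h, l) \<in> lfs c" and c: "c \<in> A'" for h l c
    proof -
      consider "c \<in> A" | "c = e" | c' where "c' \<in> A" "c = rconc i f c'" using c PA(1) unfolding A'_def by blast
      then show ?thesis
        by cases (use hl lfs_rconc[of h l i f] in \<open>auto simp: extend(4)\<close>)
    qed
    \<comment> \<open>Only \<open>j\<close> can be woken, and being fresh it has no successors and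
      was not settled.\<close>
    have live: "live A' \<subseteq> insert j (live A)" using lfs' unfolding live_def by fastforce
    have "\<forall>c\<in>A'. \<forall>h. (h, i) \<in> lfs c \<longrightarrow> cpx h = 0 \<or> (\<exists>g. h = Box g)" using lfs' g(5) ji by blast
    moreover have "\<forall>l m. l \<in> insert i (live A') \<longrightarrow> Rel l m \<in> N' \<longrightarrow> m \<noteq> i \<and> \<not> has_succ N' m \<and> (l \<noteq> i \<longrightarrow> m \<notin> live A')"
    proof (intro allI impI)
      fix l m assume l: "l \<in> insert i (live A')" and m: "Rel l m \<in> N'"
      show "m \<noteq> i \<and> \<not> has_succ N' m \<and> (l \<noteq> i \<longrightarrow> m \<notin> live A')"
      proof (cases "Rel l m \<in> N")
        case True
        then have "l \<in> insert i (live A)" "m \<noteq> j" using l live jRel by auto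
        then show ?thesis using g(4)[OF _ True] live Rels by auto
      next
        case False
        then show ?thesis using m Rels ji jRel by auto
      qed
    qed
    moreover have "justified {l. (if l = i then False else l \<notin> live A') \<and> has_succ N' l} N' A'"
    proof (rule justified_step[OF g(7)])
      fix R v c
      assume R: "finite R" "\<And>i j. Rel i j \<in> N' \<Longrightarrow> (i, j) \<in> R" and A': "\<And>c. c \<in> A' \<Longrightarrow> true_in R v c" and c: "c \<in> A"
      have "true_in R v e" using A' by (auto simp: A'_def)
      then have "eval R v f j \<le> v (BV f) i" by (simp add: extend(4))
      moreover have "eval R v (Box f) i \<le> eval R v f j" using R Rels by (intro eval_Box_le) auto
      ultimately have "eval R v (Box f) i \<le> v (BV f) i" by linarith
      then show "true_in R v c" using rconc_backward[of R v i f c] A' c by (cases "c \<in> P") (auto simp: A'_def)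
    qed (use live jRel Rels in \<open>auto simp: N'_def A'_def\<close>)
    moreover have "\<forall>l l' m. Rel l m \<in> N' \<longrightarrow> Rel l' m \<in> N' \<longrightarrow> l = l'"
      using g(3) jRel unfolding Rels by blast
    moreover have "finite N'" "A' \<subseteq> N'" using g(1,2) PA by (auto simp: N'_def A'_def)
    moreover have "has_succ N' i" using g(6) unfolding Rels by blast
    ultimately show ?thesis unfolding busy_branch_def extend(5) N'_def[symmetric] A'_def[symmetric] prod.case by blast
  qed
qed

lemma busy_lbox:
  assumes "busy_branch True i b" "lbox_branch i f b b'"
  shows "busy_branch True i b'"
proof -
  obtain N A where b: "b = (N, A)" by (cases b)
  note g = busy_branchD[OF assms(1)[unfolded b]]
  from assms(2)[unfolded b] show ?thesis
  proof (cases rule: lbox_branch_cases)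
    case keep
    then show ?thesis using assms(1) b by simp
  next
    case (extend P E)
    define N' A' where "N' = N \<union> E \<union> lconc i f ` P" and "A' = (A - P) \<union> E \<union> lconc i f ` P"
    have PA: "P \<subseteq> A" "finite P" using extend(1) g(1,2) by (auto intro: finite_subset)
    have "finite E" using finite_successors[OF g(1)] by (simp add: extend(3))
    have Rels: "Rel l m \<in> N' \<longleftrightarrow> Rel l m \<in> N" for l m
      using extend(1) Rel_notin_lconc[of P i f l m] by (auto simp: N'_def extend(3))
    have lfs': "(\<exists>c\<in>A. (h, l) \<in> lfs c) \<or> cpx h = 0 \<or> Rel i l \<in> N" if hl: "(h, l) \<in> lfs c" and c: "c \<in> A'" for h l c
    proof -
      consider "c \<in> A" | "c \<in> E" | c' where "c' \<in> A" "c = lconc i f c'" using c PA(1) unfolding A'_def by blast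
      then show ?thesis
        by cases (use hl lfs_lconc[of h l i f] in \<open>auto simp: extend(3)\<close>)
    qed
    have live: "l \<in> live A \<or> Rel i l \<in> N" if "l \<in> live A'" for l using that lfs' unfolding live_def by fastforce
    have "\<forall>c\<in>A'. \<forall>h. (h, i) \<in> lfs c \<longrightarrow> cpx h = 0 \<or> (\<exists>g. h = Box g)" using lfs' g(4)[of i i] g(5) by blast
    moreover have "\<forall>l m. l \<in> insert i (live A') \<longrightarrow> Rel l m \<in> N' \<longrightarrow> m \<noteq> i \<and> \<not> has_succ N' m \<and> (l \<noteq> i \<longrightarrow> m \<notin> live A')"
      using live g(3) g(4) unfolding Rels by blast
    moreover have "justified {l. (if l = i then True else l \<notin> live A') \<and> has_succ N' l} N' A'"
    proof (rule justified_step[OF g(7)])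
      fix R v c
      assume R: "finite R" "\<And>i j. Rel i j \<in> N' \<Longrightarrow> (i, j) \<in> R"
        "\<And>k j. k \<in> {l. (if l = i then True else l \<notin> live A') \<and> has_succ N' l} \<Longrightarrow> (k, j) \<in> R \<Longrightarrow> Rel k j \<in> N'"
        and A': "\<And>c. c \<in> A' \<Longrightarrow> true_in R v c" and c: "c \<in> A"
      obtain k where k: "(i, k) \<in> R" using g(6) R(2) Rels by blast
      have "v (BV f) i \<le> eval R v f j" if j: "(i, j) \<in> R" for j
      proof -
        \<comment> \<open>As \<open>i\<close> now counts as settled, \<open>R\<close> has no edges
          at \<open>i\<close> beyond those of the branch, so \<open>E\<close> covers every
          successor.\<close>
        have "Rel i j \<in> N" using R(3)[OF _ j] g(6) Rels by auto
        then have "true_in R v (Ineq {#(f, j)#} Ge {#(At (BV f), i)#})" by (intro A') (auto simp: A'_def extend(3))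
        then show ?thesis by simp
      qed
      then have "v (BV f) i \<le> eval R v (Box f) i" by (rule eval_Box_ge[OF k])
      then show "true_in R v c" using lconc_backward[of R v i f c] A' c by (cases "c \<in> P") (auto simp: A'_def)
    next
      show "{l. (if l = i then True else l \<notin> live A) \<and> has_succ N l} \<subseteq> {l. (if l = i then True else l \<notin> live A') \<and> has_succ N' l}"
      proof
        fix l assume "l \<in> {l. (if l = i then True else l \<notin> live A) \<and> has_succ N l}"
        then have l: "l = i \<or> l \<notin> live A" "has_succ N l" by (auto split: if_splits)
        \<comment> \<open>A settled label has a successor and successors of \<open>i\<close> have
          none, so waking the latter unsettles nothing.\<close>
        moreover have "\<not> Rel i l \<in> N" using g(4)[of i l] l(2) by blast
        ultimately show "l \<in> {l. (if l = i then True else l \<notin> live A') \<and> has_succ N' l}"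
          using live[of l] by (auto simp: Rels)
      qed
    qed (use Rels in \<open>auto simp: N'_def A'_def\<close>)
    moreover have "\<forall>l l' m. Rel l m \<in> N' \<longrightarrow> Rel l' m \<in> N' \<longrightarrow> l = l'"
      using g(3) unfolding Rels by blast
    moreover have "finite N'" "A' \<subseteq> N'" using g(1,2) PA \<open>finite E\<close> by (auto simp: N'_def A'_def)
    moreover have "has_succ N' i" using g(6) unfolding Rels by blast
    ultimately show ?thesis unfolding busy_branch_def extend(4) N'_def[symmetric] A'_def[symmetric] prod.case by blast
  qed
qed

text \<open>The passage from step 5 to step 6: left boxes create no edges, so the set of successors
  of \<open>i\<close> can be declared final.\<close>

lemma busy_mono:
  assumes "busy_branch False i b" shows "busy_branch True i b"
proof -
  obtain N A where b: "b = (N, A)" by (cases b)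
  note g = busy_branchD[OF assms[unfolded b]]
  have "justified {l. (if l = i then True else l \<notin> live A) \<and> has_succ N l} N A"
    by (rule justified_mono[OF g(7)]) auto
  then show ?thesis using g(1-6) unfolding b busy_branch_def prod.case by blast
qed

text \<open>Label \<open>i\<close> carries only atoms and boxes; without boxes it is no longer live
  and, having a successor, is settled from now on.\<close>

lemma busy_end:
  assumes "busy_branch True i (N, A)" "\<not> has_box i A"
  shows "good_branch (N, A)"
proof -
  note g = busy_branchD[OF assms(1)]
  have "i \<notin> live A"
  proof
    assume "i \<in> live A"
    then obtain c h where c: "c \<in> A" "(h, i) \<in> lfs c" "cpx h > 0" by (auto simp: live_def)
    then obtain f where "h = Box f" using g(5)[OF c(1,2)] by auto
    moreover obtain G r D where "c = Ineq G r D" using c(2) by (cases c) auto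
    ultimately have "rbox_at i f c \<or> lbox_at i f c" using c(2) by (auto simp: rbox_at_def lbox_at_def)
    then show False using c(1) assms(2) by blast
  qed
  then have "{l. (if l = i then True else l \<notin> live A) \<and> has_succ N l} = {l. l \<notin> live A \<and> has_succ N l}" by auto
  then have "justified {l. l \<notin> live A \<and> has_succ N l} N A" using g(7) by simp
  moreover have "j \<notin> live A \<and> \<not> has_succ N j" if "l \<in> live A" "Rel l j \<in> N" for l j
    using g(4)[of l j] that \<open>i \<notin> live A\<close> by blast
  ultimately show ?thesis using g(1-3) unfolding good_branch_def prod.case by blast
qed

text \<open>Only the branches with a box at \<open>i\<close> take part in the phase; the others stay
  untouched and good.\<close>

abbreviation phase_branch :: "bool \<Rightarrow> nat \<Rightarrow> 'v vs node set \<times> 'v vs node set \<Rightarrow> bool" where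
  "phase_branch q i b \<equiv> good_branch b \<and> \<not> has_box i (snd b) \<or> busy_branch q i b"

lemma phase_rbox:
  assumes "phase_branch False i b" "rbox_branch i f b b'" shows "phase_branch False i b'"
proof (cases "busy_branch False i b")
  case True
  then have "busy_branch False i b'" using assms(2) by (rule busy_rbox)
  then show ?thesis ..
next
  case False
  then have *: "good_branch b \<and> \<not> has_box i (snd b)" using assms(1) by (simp only: simp_thms)
  obtain N A where b: "b = (N, A)" by (cases b)
  from assms(2)[unfolded b] have "b' = b" using * b by (cases rule: rbox_branch_cases) auto
  then show ?thesis using * by (simp only: simp_thms)
qed

lemma phase_lbox:
  assumes "phase_branch True i b" "lbox_branch i f b b'" shows "phase_branch True i b'"
proof (cases "busy_branch True i b")
  case True
  then have "busy_branch True i b'" using assms(2) by (rule busy_lbox)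
  then show ?thesis ..
next
  case False
  then have *: "good_branch b \<and> \<not> has_box i (snd b)" using assms(1) by (simp only: simp_thms)
  obtain N A where b: "b = (N, A)" by (cases b)
  from assms(2)[unfolded b] have "b' = b" using * b by (cases rule: lbox_branch_cases) auto
  then show ?thesis using * by (simp only: simp_thms)
qed

text \<open>Step 6 ends by excluding left boxes only; this preserves what step 5 achieved for right
  boxes.\<close>

lemma lbox_branch_no_rbox:
  assumes "lbox_branch i f b b'" "\<forall>c\<in>snd b. \<forall>g. \<not> rbox_at i g c" shows "\<forall>c\<in>snd b'. \<forall>g. \<not> rbox_at i g c"
proof -
  obtain N A where b: "b = (N, A)" by (cases b)
  have lc: "rbox_at i g (lconc i f c) \<longleftrightarrow> rbox_at i g c" for g c by (cases c) (auto simp: rbox_at_def)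
  from assms(1)[unfolded b] show ?thesis
  proof (cases rule: lbox_branch_cases)
    case keep
    then show ?thesis using assms(2) b by simp
  next
    case (extend P E)
    have "\<not> rbox_at i g e" if "e \<in> E" for g e using that unfolding extend(3) rbox_at_def by auto
    then show ?thesis using assms(2) unfolding extend(4) extend(1) b snd_conv by (auto simp: lc)
  qed
qed

lemma good_box_phase:
  assumes "\<forall>b\<in>T. good_branch b" "prop_done T" "box_phase T T'"
  shows "\<forall>b\<in>T'. good_branch b"
proof (cases "T' = T")
  case False
  then obtain i T2 T3 where ph: "ex_step i T T2" "step5 i T2 T3" "step6 i T3 T'"
    using assms(3) by (auto simp: box_phase_def)
  obtain h where h: "T2 = h ` T" "\<forall>b\<in>T. ex_branch i b (h b)" using ph(1) unfolding ex_step_iff by blast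
  have "phase_branch False i (h (N, A))" if NA: "(N, A) \<in> T" for N A
    using h(2)[rule_format, OF NA]
  proof (cases rule: ex_branch_cases)
    case keep
    then show ?thesis using assms(1) NA by auto
  next
    case (extend k)
    have "\<forall>c\<in>A. \<not> (\<exists>alts. prop_rule c alts)" using assms(2) NA unfolding prop_done_def by blast
    then show ?thesis using busy_start[OF _ extend(1,2)] assms(1) NA unfolding extend(3) by blast
  qed
  then have T2: "\<forall>b\<in>T2. phase_branch False i b" unfolding h(1) by (intro ballI) (elim imageE, metis surj_pair)
  have "(\<lambda>X Y. \<exists>f. (\<exists>(N, A)\<in>X. \<exists>c\<in>A. rbox_at i f c) \<and> rbox_step i f X Y)\<^sup>*\<^sup>* T2 T3"
    using ph(2) by (auto simp: step5_def)
  then have "\<forall>b\<in>T3. phase_branch False i b" using T2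
  proof (induction rule: rtranclp_induct)
    case (step X Y)
    then obtain f h where h: "Y = h ` X" "\<forall>b\<in>X. rbox_branch i f b (h b)" unfolding rbox_step_iff by blast
    show ?case unfolding h(1)
    proof (intro ballI, elim imageE)
      fix b' b assume b: "b' = h b" "b \<in> X"
      have "phase_branch False i b" using step.IH step.prems b(2) by blast
      then show "phase_branch False i b'" unfolding b(1) by (rule phase_rbox[OF _ h(2)[rule_format, OF b(2)]])
    qed
  qed
  moreover have "\<forall>b\<in>T3. \<forall>c\<in>snd b. \<forall>g. \<not> rbox_at i g c" using ph(2) unfolding step5_def split_def by blast
  ultimately have T3: "\<forall>b\<in>T3. phase_branch True i b \<and> (\<forall>c\<in>snd b. \<forall>g. \<not> rbox_at i g c)" using busy_mono by blast
  have "(\<lambda>X Y. \<exists>f. (\<exists>(N, A)\<in>X. \<exists>c\<in>A. lbox_at i f c) \<and> lbox_step i f X Y)\<^sup>*\<^sup>* T3 T'"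
    using ph(3) by (auto simp: step6_def)
  then have "\<forall>b\<in>T'. phase_branch True i b \<and> (\<forall>c\<in>snd b. \<forall>g. \<not> rbox_at i g c)" using T3
  proof (induction rule: rtranclp_induct)
    case (step X Y)
    then obtain f h where h: "Y = h ` X" "\<forall>b\<in>X. lbox_branch i f b (h b)" unfolding lbox_step_iff by blast
    show ?case unfolding h(1)
    proof (intro ballI, elim imageE)
      fix b' b assume b: "b' = h b" "b \<in> X"
      have *: "phase_branch True i b" "\<forall>c\<in>snd b. \<forall>g. \<not> rbox_at i g c" using step.IH step.prems b(2) by blast+
      note lb = h(2)[rule_format, OF b(2)]
      show "phase_branch True i b' \<and> (\<forall>c\<in>snd b'. \<forall>g. \<not> rbox_at i g c)" unfolding b(1)
        using phase_lbox[OF *(1) lb] lbox_branch_no_rbox[OF lb *(2)] by blast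
    qed
  qed
  moreover have "\<forall>b\<in>T'. \<forall>c\<in>snd b. \<forall>g. \<not> lbox_at i g c" using ph(3) unfolding step6_def split_def by blast
  ultimately have end_T': "\<forall>b\<in>T'. phase_branch True i b \<and> \<not> has_box i (snd b)" by blast
  show ?thesis
  proof
    fix b assume "b \<in> T'"
    then show "good_branch b" using end_T' busy_end[of i "fst b" "snd b"] unfolding prod.collapse by blast
  qed
qed (use assms in blast)

lemma good_p_step:
  assumes "\<forall>b\<in>T. good_branch b" "p_step T T'" shows "\<forall>b\<in>T'. good_branch b"
proof -
  obtain N A c alts where st: "(N, A) \<in> T" "c \<in> A" "prop_rule c alts"
    "T' = (T - {(N, A)}) \<union> (\<lambda>C. (N \<union> C, (A - {c}) \<union> C)) ` set alts"
    using assms(2) by (auto simp: p_step_def)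
  show ?thesis unfolding st(4)
  proof
    fix b assume "b \<in> (T - {(N, A)}) \<union> (\<lambda>C. (N \<union> C, (A - {c}) \<union> C)) ` set alts"
    then show "good_branch b"
      using assms(1) good_branch_p_step[OF _ st(2,3), of N] st(1) by blast
  qed
qed

text \<open>The relation of the branch agrees with \<open>N\<close> at every label, so it is
  admissible for \<open>justified\<close>. Active inequations of complexity 0 contain atoms only
  (\<open>Zero\<close> counts 1) and thus belong to the solved system.\<close>

lemma open_branch_model:
  assumes "good_branch (N, A)" "\<forall>c\<in>A. ineq_cpx c = 0" "\<not> branch_closed lkp_isv N"
  shows "\<exists>R v. finite R \<and> true_in R v root"
proof -
  obtain a where a: "\<And>G r D. Ineq G r D \<in> N \<Longrightarrow> (\<forall>x\<in>#G + D. lkp_isv (fst x)) \<Longrightarrow> holds r (msum a G) (msum a D)"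
    using assms(3) unfolding branch_closed_def by blast
  define R where "R = {(i, j). Rel i j \<in> N}"
  define v where "v q i = a (At q, i)" for q i
  note g = good_branchD[OF assms(1)]
  have "R = (\<lambda>(i, j). Rel i j) -` N" by (auto simp: R_def)
  then have fin: "finite R" using g(1) by (auto intro!: finite_vimageI simp: inj_on_def)
  have "true_in R v c" if c: "c \<in> A" for c
  proof (cases c)
    case (Ineq G r D)
    have "cpx (fst x) = 0" if "x \<in># G + D" for x
      using assms(2) c Ineq that by (fastforce simp: ineq_cpx_Ineq)
    then have At: "\<exists>q. fst x = At q" if "x \<in># G + D" for x using that by (metis cpx.elims nat.distinct(1) zero_neq_one)
    have "lval R v (\<lambda>i. i) x = a x" if "x \<in># G + D" for x
      using At[OF that] by (cases x) (auto simp: v_def)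
    then have "image_mset (lval R v (\<lambda>i. i)) G = image_mset a G" "image_mset (lval R v (\<lambda>i. i)) D = image_mset a D"
      by (auto intro!: image_mset_cong)
    moreover have "holds r (msum a G) (msum a D)"
      using At c g(2) Ineq by (intro a) (auto simp: lkp_isv_def)
    ultimately show ?thesis using Ineq by simp
  qed simp
  then have "true_in R v root" using g(5) fin unfolding justified_def R_def by auto
  then show ?thesis using fin by blast
qed

end

lemma good_run:
  assumes "lkp_run f T"
  shows "\<forall>b\<in>T. good_branch (Ineq {#} Gt {#(map_fm OV f, 1)#}) b"
  using assms
proof induction
  case init
  \<comment> \<open>Only 1 can be live, and its successor 2 is a leaf; the root is itself active,
    hence trivially justified.\<close>
  have "live {Ineq {#} Gt {#(map_fm OV f, 1)#}} \<subseteq> {1}" by (auto simp: live_def)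
  then show ?case by (auto simp: root_state_def good_branch_def justified_def)
next
  case (step T T1 T')
  have "\<forall>b\<in>T1. good_branch (Ineq {#} Gt {#(map_fm OV f, 1)#}) b"
    using step.hyps(3) step.IH by (induction rule: rtranclp_induct) (use good_p_step in blast)+
  then show ?case using good_box_phase step.hyps(4,5) by blast
qed

section \<open>Transfer of a finite countermodel to the given world type\<close>

lemma finite_set_fm: "finite (set_fm g)"
  by (induction g) auto

lemma kvalid_finite_model:
  fixes f :: "nat fm" and R :: "(nat \<times> nat) set"
  assumes inf: "infinite (UNIV :: 'w set)" and val: "kvalid TYPE('w) f" and R: "finite R"
  shows "eval R V f x \<ge> 0"
proof -
  obtain u :: "nat \<Rightarrow> 'w" where u: "inj u" using infinite_countable_subset[OF inf] by blast
  \<comment> \<open>A model needs one bound for all variables, but a solution of the system is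
    arbitrary on those outside \<open>f\<close>. Resetting these to 0 leaves finitely many values on
    \<open>Y\<close>, bounded by the sum \<open>r\<close>.\<close>
  define V0 where "V0 p y = (if p \<in> set_fm f then V p y else 0)" for p y
  define R' where "R' = map_prod u u ` R"
  define V' where "V' p w = V0 p (inv u w)" for p w
  define Y where "Y = insert x (fst ` R \<union> snd ` R)"
  define r where "r = (\<Sum>p\<in>set_fm f. \<Sum>y\<in>Y. \<bar>V p y\<bar>)"
  have "finite Y" using R by (simp add: Y_def)
  have "r \<ge> 0" by (auto simp: r_def intro!: sum_nonneg)
  have bd: "\<bar>V0 p y\<bar> \<le> r" if "y \<in> Y" for p y
  proof (cases "p \<in> set_fm f")
    case True
    have "\<bar>V p y\<bar> \<le> (\<Sum>y\<in>Y. \<bar>V p y\<bar>)" using that \<open>finite Y\<close> by (intro member_le_sum) auto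
    also have "\<dots> \<le> r" unfolding r_def using True finite_set_fm[of f]
      by (intro member_le_sum[of p "set_fm f" "\<lambda>p. \<Sum>y\<in>Y. \<bar>V p y\<bar>"]) (auto intro: sum_nonneg)
    finally show ?thesis using True by (simp add: V0_def)
  qed (use \<open>r \<ge> 0\<close> in \<open>simp add: V0_def\<close>)
  have "kmodel (u ` Y) R' V'" unfolding kmodel_def
  proof (intro conjI exI[of _ r] allI ballI)
    show "R' \<subseteq> u ` Y \<times> u ` Y" by (force simp: R'_def Y_def)
    show "\<bar>V' p z\<bar> \<le> r" if "z \<in> u ` Y" for p z using that bd u by (auto simp: V'_def)
  qed (use \<open>r \<ge> 0\<close> in \<open>auto simp: Y_def\<close>)
  then have "eval R' V' f (u x) \<ge> 0" using val unfolding kvalid_def by (auto simp: Y_def)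
  moreover have "eval R' V' g (u y) = eval R V0 g y" for g y
  proof (induction g arbitrary: y)
    case (Box g)
    have *: "{z. (u y, z) \<in> R'} = u ` {z. (y, z) \<in> R}" using u by (auto simp: R'_def inj_eq)
    show ?case unfolding eval.simps * image_image Box.IH by simp
  qed (use u in \<open>auto simp: V'_def\<close>)
  moreover have "eval R V0 f x = eval R V f x" by (rule eval_cong_vars) (simp add: V0_def)
  ultimately show ?thesis by simp
qed

text \<open>The argument closes every complete tableau of a valid formula; termination supplies
  one.\<close>

lemma kvalid_closed_complete_tab:
  fixes f :: "nat fm"
  assumes "infinite (UNIV :: 'w set)" "kvalid TYPE('w) f"
  shows "closed_complete_tab f"
proof -
  obtain T where T: "complete_tab f T" using complete_tab_exists by blast
  have "branch_closed lkp_isv N" if NA: "(N, A) \<in> T" for N A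
  proof (rule ccontr)
    assume op: "\<not> branch_closed lkp_isv N"
    have zero: "\<forall>c\<in>A. ineq_cpx c = 0" using T NA by (auto simp: complete_tab_def all_zero_def)
    have good: "good_branch (Ineq {#} Gt {#(map_fm OV f, 1)#}) (N, A)"
      using good_run[of f T] T NA by (auto simp: complete_tab_def)
    have "\<exists>R v. finite R \<and> true_in R v (Ineq {#} Gt {#(map_fm OV f, 1)#})"
      by (rule open_branch_model[OF good zero op])
    then obtain R v where R: "finite R" and v: "true_in R v (Ineq {#} Gt {#(map_fm OV f, 1)#})" by blast
    from v have "eval R (\<lambda>p. v (OV p)) f 1 < 0" by (simp add: eval_map_fm)
    then show False using kvalid_finite_model[OF assms R, of "\<lambda>p. v (OV p)" 1] by simp
  qed
  then show ?thesis using T by (auto simp: closed_complete_tab_def)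
qed

theorem theorem3p7:
  fixes f :: "nat fm"
  assumes "infinite (UNIV :: 'w set)"
  shows "(closed_complete_tab f \<longleftrightarrow> lk_derivable f) \<and> (lk_derivable f \<longleftrightarrow> kvalid TYPE('w) f)"
  using closed_complete_tab_derivable lk_sound[where 'w = 'w] kvalid_closed_complete_tab[OF assms] by blast

end
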